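(* Let $(\xi_{m,k})_{m\ge0,\,0\le k<2^m}$ be independent Rademacher random variables, $\mathbb P(\xi_{m,k}=1)=\mathbb P(\xi_{m,k}=-1)=\tfrac12$, and let $c\ne0$ and $a\in\mathbb R$. Consider the random Faber–Schauder series $$X(t)=X(0)+at+c\sum_{m=0}^\infty\sum_{k=0}^{2^m-1}\xi_{m,k}\,e_{m,k}(t),\qquad t\in[0,1].$$ Then $$\mathbb P\bigl(X\in\mathscr R_2([0,1])\bigr)=1\qquad\text{and}\qquad\mathbb P\bigl([X]^2(t)=c^2t\text{ for all }t\in[0,1]\bigr)=1.$$ More precisely, almost surely, $$\Omega_2^{c^2\mathrm{id}}(X;\delta)=O\left(\sqrt{\delta\log\frac e\delta}\right)\quad(\delta\downarrow0),$$ and consequently, almost surely, $$\mathfrak R_{2,L}(X)=O\left(\sqrt{\frac{\log(eL)}{L}}\right)\quad(L\to\infty),$$ where the implied constants may be random. In particular, almost surely $\lim_{L\to\infty}\mathfrak R_{2,L}(X)=0$.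
   Context: Dyadic Faber–Schauder functions on $[0,1]$: $e_{m,k}(t):=2^{-m/2}\varphi(2^mt-k)$, $\varphi(u):=\max\{0,\min\{u,1-u\}\}$, $m\ge0$, $0\le k<2^m$. For a finite partition $\lambda=\{0=u_0<\dots<u_N=1\}$ and $t\in[0,1]$, $\mathsf V^2_\lambda(x;t):=\sum_{i}|x(u_{i+1}\wedge t)-x(u_i\wedge t)|^2$. For $0<\ell\le1$, $0\le s<\ell$, $\Pi(\ell,s):=\{0,1\}\cup\{s+k\ell:k\in\mathbb Z,\ 0<s+k\ell<1\}$. For continuous nondecreasing $A$ with $A(0)=0$, $\Omega_2^A(x;\delta):=\sup_{0<\ell\le\delta}\sup_{0\le s<\ell}\sup_{t\in[0,1]}|\mathsf V^2_{\Pi(\ell,s)}(x;t)-A(t)|$; $\Omega_2^{c^2\mathrm{id}}$ is the case $A(t)=c^2t$. $\mathscr R_2([0,1])$ is the class of $2$-rough paths: $x\in C([0,1];\mathbb R)$ such that $\Omega_2^A(x;\delta)\to0$ as $\delta\downarrow0$ for some continuous nondecreasing $A:[0,1]\to[0,\infty)$ with $A(1)>A(0)=0$; this $A$ is unique and denoted $[x]^2$. $\mathbb T_m:=\{j2^{-m}:0\le j\le2^m\}$; for integers $1\le b\le 2^m$, $0\le r<b$, $\mathbb T_m^{b,r}:=\{0,1\}\cup\{j2^{-m}:1\le j<2^m,\ j\equiv r\pmod b\}$; for integers $L\ge2$, $$\mathfrak R_{2,L}(x):=\limsup_{m\to\infty}\ \sup_{L\le b\le\lfloor2^m/L\rfloor,\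 0\le r<b}\ \sup_{t\in[0,1]}\bigl|\mathsf V^2_{\mathbb T_m^{b,r}}(x;t)-\mathsf V^2_{\mathbb T_m}(x;t)\bigr|.$$ *)

theory Defs
  imports "HOL-Probability.Probability" "HOL-Number_Theory.Cong"
begin

subsection \<open>Faber--Schauder functions\<close>

definition fs_phi :: "real \<Rightarrow> real" where
  "fs_phi u = max 0 (min u (1 - u))"

definition faber_schauder :: "nat \<Rightarrow> nat \<Rightarrow> real \<Rightarrow> real" where
  "faber_schauder m k t = 2 powr (- real m / 2) * fs_phi (2 ^ m * t - real k)"

subsection \<open>Quadratic variation along partitions\<close>

text \<open>A finite partition of $[0,1]$ is represented by its set of points; the sorted list of
  these points recovers the enumeration $u_0 < \dots < u_N$, with $N + 1$ the cardinality.\<close>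

definition quad_var :: "real set \<Rightarrow> (real \<Rightarrow> real) \<Rightarrow> real \<Rightarrow> real" where
  "quad_var P x t =
     (let u = (\<lambda>i. sorted_list_of_set P ! i)
      in \<Sum>i<card P - 1. \<bar>x (min (u (Suc i)) t) - x (min (u i) t)\<bar> ^ 2)"

definition shifted_grid :: "real \<Rightarrow> real \<Rightarrow> real set" where
  "shifted_grid l s = {0, 1} \<union> {s + of_int k * l | k :: int. 0 < s + of_int k * l \<and> s + of_int k * l < 1}"

lemma finite_shifted_grid:
  assumes "l > 0"
  shows "finite (shifted_grid l s)"
proof -
  have "k \<in> {\<lfloor>- s / l\<rfloor>..\<lceil>(1 - s) / l\<rceil>}"
    if "0 < s + of_int k * l" "s + of_int k * l < 1" for k :: int
  proof -
    have "- s / l < of_int k" "of_int k < (1 - s) / l"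
      using that assms by (simp_all add: field_simps)
    then show ?thesis by (simp add: floor_le_iff le_ceiling_iff)
  qed
  then have "shifted_grid l s \<subseteq> {0, 1} \<union> (\<lambda>k. s + of_int k * l) ` {\<lfloor>- s / l\<rfloor>..\<lceil>(1 - s) / l\<rceil>}"
    unfolding shifted_grid_def by blast
  then show ?thesis by (rule finite_subset) simp
qed

text \<open>The modulus takes values in $[0,\infty]$, since the supremum over all mesh sizes
  $\ell \le \delta$ may be infinite for a general continuous path.\<close>

definition Omega2 :: "(real \<Rightarrow> real) \<Rightarrow> (real \<Rightarrow> real) \<Rightarrow> real \<Rightarrow> ennreal" where
  "Omega2 A x \<delta> =
     (SUP l\<in>{l. 0 < l \<and> l \<le> 1 \<and> l \<le> \<delta>}. SUP s\<in>{0..<l}. SUP t\<in>{0..1}.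
        ennreal \<bar>quad_var (shifted_grid l s) x t - A t\<bar>)"

subsection \<open>2-rough paths\<close>

definition is_rough_qv :: "(real \<Rightarrow> real) \<Rightarrow> (real \<Rightarrow> real) \<Rightarrow> bool" where
  "is_rough_qv x A \<longleftrightarrow>
     continuous_on {0..1} A \<and> mono_on {0..1} A \<and> A 0 = 0 \<and> A 1 > A 0 \<and>
     ((\<lambda>\<delta>. Omega2 A x \<delta>) \<longlongrightarrow> 0) (at_right 0)"

definition rough_paths2 :: "(real \<Rightarrow> real) set" where
  "rough_paths2 = {x. continuous_on {0..1} x \<and> (\<exists>A. is_rough_qv x A)}"

text \<open>Restricting to functions that are \<open>undefined\<close> outside $[0,1]$ makes the limit unique as a
  function on the whole real line.\<close>

definition rough_qv :: "(real \<Rightarrow> real) \<Rightarrow> real \<Rightarrow> real" where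
  "rough_qv x = (THE A. A \<in> extensional {0..1} \<and> is_rough_qv x A)"

lemma is_rough_qv_unique:
  assumes A: "is_rough_qv x A" and B: "is_rough_qv x B" and t: "t \<in> {0..1}"
  shows "A t = B t"
proof -
  have le: "ennreal \<bar>quad_var (shifted_grid \<delta> 0) x t - D t\<bar> \<le> Omega2 D x \<delta>"
    if "0 < \<delta>" "\<delta> < 1" for \<delta> D
    unfolding Omega2_def
    by (rule SUP_upper2[where i = \<delta>], use that in simp, rule SUP_upper2[where i = 0],
        use that in simp, rule SUP_upper2[OF t]) simp
  have bd: "ennreal \<bar>A t - B t\<bar> \<le> Omega2 A x \<delta> + Omega2 B x \<delta>" if "0 < \<delta>" "\<delta> < 1" for \<delta>
  proof -
    let ?q = "quad_var (shifted_grid \<delta> 0) x t"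
    have "ennreal \<bar>A t - B t\<bar> \<le> ennreal (\<bar>?q - A t\<bar> + \<bar>?q - B t\<bar>)"
      by (intro ennreal_leI) linarith
    also have "\<dots> = ennreal \<bar>?q - A t\<bar> + ennreal \<bar>?q - B t\<bar>"
      by (simp add: ennreal_plus)
    also have "\<dots> \<le> Omega2 A x \<delta> + Omega2 B x \<delta>"
      by (intro add_mono le that)
    finally show ?thesis .
  qed
  have lim: "((\<lambda>\<delta>. Omega2 A x \<delta> + Omega2 B x \<delta>) \<longlongrightarrow> 0 + 0) (at_right 0)"
    using A B unfolding is_rough_qv_def by (intro tendsto_add) auto
  have ev: "eventually (\<lambda>\<delta>. ennreal \<bar>A t - B t\<bar> \<le> Omega2 A x \<delta> + Omega2 B x \<delta>) (at_right 0)"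
    using bd by (auto intro!: eventually_at_rightI[of 0 1])
  have "ennreal \<bar>A t - B t\<bar> \<le> 0"
    using tendsto_lowerbound[OF lim ev] by simp
  then show ?thesis by simp
qed

lemma is_rough_qv_cong:
  assumes "\<And>t. t \<in> {0..1} \<Longrightarrow> A t = B t"
  shows "is_rough_qv x A \<longleftrightarrow> is_rough_qv x B"
proof -
  have "Omega2 A x = Omega2 B x"
    unfolding Omega2_def using assms by (intro ext SUP_cong) auto
  moreover have "continuous_on {0..1} A \<longleftrightarrow> continuous_on {0..1} B"
    using assms by (intro continuous_on_cong) auto
  moreover have "mono_on {0..1} A \<longleftrightarrow> mono_on {0..1} B"
    using assms by (auto simp: mono_on_def)
  ultimately show ?thesis
    unfolding is_rough_qv_def using assms[of 0] assms[of 1] by simp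
qed

lemma rough_qv_eq:
  assumes A: "is_rough_qv x A" and t: "t \<in> {0..1}"
  shows "rough_qv x t = A t"
proof -
  have "rough_qv x = restrict A {0..1}"
    unfolding rough_qv_def
  proof (rule the_equality)
    show "restrict A {0..1} \<in> extensional {0..1} \<and> is_rough_qv x (restrict A {0..1})"
      using A is_rough_qv_cong[of A "restrict A {0..1}" x] by simp
  next
    fix B assume B: "B \<in> extensional {0..1} \<and> is_rough_qv x B"
    show "B = restrict A {0..1}"
      by (rule extensionalityI[of B "{0..1}"])
         (use B is_rough_qv_unique[of x B A] A in auto)
  qed
  with t show ?thesis by simp
qed

subsection \<open>Dyadic regular grids\<close>

definition dyadic_grid :: "nat \<Rightarrow> real set" where
  "dyadic_grid m = {real j / 2 ^ m | j. j \<le> 2 ^ m}"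

definition dyadic_subgrid :: "nat \<Rightarrow> nat \<Rightarrow> nat \<Rightarrow> real set" where
  "dyadic_subgrid m b r = {0, 1} \<union> {real j / 2 ^ m | j. 1 \<le> j \<and> j < 2 ^ m \<and> [j = r] (mod b)}"

text \<open>The range of $b$ is empty for small $m$; the empty supremum is $0$ and does not affect the
  limit superior. On natural numbers, $\lfloor 2^m / L \rfloor$ is \<open>2 ^ m div L\<close>.\<close>

definition R2 :: "nat \<Rightarrow> (real \<Rightarrow> real) \<Rightarrow> ennreal" where
  "R2 L x =
     limsup (\<lambda>m. SUP b\<in>{L..2 ^ m div L}. SUP r\<in>{..<b}. SUP t\<in>{0..1}.
        ennreal \<bar>quad_var (dyadic_subgrid m b r) x t - quad_var (dyadic_grid m) x t\<bar>)"

end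

theory Submission
  imports Defs "HOL-Library.Discrete_Functions" "HOL-Real_Asymp.Real_Asymp"
begin

text \<open>Since all coefficients are $\pm 1$, the path is deterministically 1/2-Hoelder continuous. Adding
  the coefficients one at a time, the quadratic variation $V$ along a fixed partition of mesh $\ell$
  changes by a deterministic term, which sums to $c^2 t + O(\ell)$ by Parseval's identity for the Haar
  functions, and by $2 c \xi \langle Y, e \rangle$, where $Y$ is the partial sum built so far and
  $\langle Y, e \rangle$ the sum of products of increments of $Y$ and $e$ over the partition. These are
  martingale increments with deterministic bounds whose squares sum to $O(\ell)$, so the
  Azuma--Hoeffding inequality gives Gaussian tails on the scale $\sqrt\ell$. A union bound over a
  polynomially fine grid of triples $(\ell, s, t)$, Borel--Cantelli, and Hoelder continuity between grid
  points yield the modulus $\sqrt{\ell \log(e/\ell)}$.\<close>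

subsection \<open>Increments of Faber--Schauder functions\<close>

text \<open>Rounding the nodes to the dyadic grid of level 4n does more than make the union bound
  finite. Every function of level at least 4n vanishes on that grid, so at rounded nodes the path is
  exactly a finite sum with 2^{4n} - 1 signs, Parseval's identity has no remainder, and the tails of
  the martingale can be obtained by counting sign vectors. The exponent 4n comes from about 2^n
  gaps, each perturbed by the square root of a node displacement of order 2^{-3n}: together 2^n *
  2^{-3n/2} = 2^{-n/2}. The threshold is tuned to a failure probability of order exp(-13 n) per
  partition, against at most 8 * 2^{12n} partitions; this union bound is the only source of the
  logarithm. The estimate for \<open>R2\<close> needs no further randomness: a dyadic subgrid of
  step b is a shifted grid of mesh b / 2^m <= 1 / L, so comparing it and the full dyadic grid with
  c^2 t costs twice the modulus at 1 / L.\<close>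

lemma sqrt2_power_mult_self: "sqrt 2 ^ m * sqrt 2 ^ m = (2::real) ^ m"
  by (simp flip: power_mult_distrib)

lemma faber_schauder_eq: "faber_schauder m k t = fs_phi (2 ^ m * t - real k) / sqrt 2 ^ m"
proof -
  have "sqrt 2 ^ m = 2 powr (real m / 2)"
    by (simp add: powr_half_sqrt[symmetric] powr_powr flip: powr_realpow)
  then have "2 powr (- real m / 2) = 1 / sqrt 2 ^ m"
    by (simp add: powr_minus_divide)
  then show ?thesis by (simp add: faber_schauder_def)
qed

lemma fs_phi_nonneg: "0 \<le> fs_phi u"
  and fs_phi_le: "fs_phi u \<le> 1 / 2"
  and fs_phi_of_int: "fs_phi (of_int z) = 0"
proof -
  show "0 \<le> fs_phi u" "fs_phi u \<le> 1 / 2" by (auto simp: fs_phi_def max_def min_def)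
  show "fs_phi (of_int z) = 0"
    by (cases "z \<le> 0") (auto simp: fs_phi_def)
qed

lemma faber_schauder_nonneg: "0 \<le> faber_schauder m k t"
  by (simp add: faber_schauder_eq fs_phi_nonneg)

text \<open>The length of $[0,t] \cap [k 2^{-n}, (k+1) 2^{-n}]$ for $t \ge 0$; the primitives of Haar
  functions are differences of two such lengths.\<close>

definition dyadic_part :: "nat \<Rightarrow> nat \<Rightarrow> real \<Rightarrow> real" where
  "dyadic_part n k t = max 0 (min (1 / 2 ^ n) (t - real k / 2 ^ n))"

lemma dyadic_part_mono: "u \<le> v \<Longrightarrow> dyadic_part n k u \<le> dyadic_part n k v"
  and dyadic_part_nonneg: "0 \<le> dyadic_part n k t"
  and dyadic_part_le: "dyadic_part n k t \<le> 1 / 2 ^ n"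
  by (auto simp: dyadic_part_def)

lemma dyadic_part_split:
  "dyadic_part n k t = dyadic_part (Suc n) (2 * k) t + dyadic_part (Suc n) (2 * k + 1) t"
proof -
  define d :: real where "d = 1 / 2 ^ Suc n"
  have d: "0 < d" "1 / 2 ^ n = 2 * d" "real k / 2 ^ n = 2 * real k * d"
    "1 / 2 ^ Suc n = d" "real (2 * k) / 2 ^ Suc n = 2 * real k * d"
    "real (2 * k + 1) / 2 ^ Suc n = 2 * real k * d + d"
    by (auto simp: d_def field_simps)
  show ?thesis unfolding dyadic_part_def d(2-) using d(1) by (auto simp: max_def min_def)
qed

text \<open>This is the primitive of the L2-normalised Haar function, with values
  \<open>sqrt 2 ^ m\<close> and \<open>- sqrt 2 ^ m\<close> on the two halves of its dyadic
  interval.\<close>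

lemma faber_schauder_dyadic_part:
  "faber_schauder m k t =
     sqrt 2 ^ m * (dyadic_part (Suc m) (2 * k) t - dyadic_part (Suc m) (2 * k + 1) t)"
proof -
  define x where "x = 2 ^ m * t - real k"
  have t: "t = (x + real k) / 2 ^ m" by (simp add: x_def)
  have scale: "max 0 (min (c / q) (d / q)) = max 0 (min c d) / q" if "0 < q" for c d q :: real
    using that by (auto simp: max_def min_def divide_le_cancel zero_le_divide_iff)
  note scale = scale[of "2 ^ m", OF zero_less_power[OF zero_less_numeral]]
  have 1: "dyadic_part (Suc m) (2 * k) t = max 0 (min (1/2) x) / 2 ^ m"
    unfolding scale[symmetric] dyadic_part_def t by (simp add: field_simps)
  have "t - real (2 * k + 1) / 2 ^ Suc m = (x - 1/2) / 2 ^ m"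
    unfolding t by (simp add: add_divide_distrib diff_divide_distrib)
  then have 2: "dyadic_part (Suc m) (2 * k + 1) t = max 0 (min (1/2) (x - 1/2)) / 2 ^ m"
    unfolding scale[symmetric] dyadic_part_def by simp
  have "max 0 (min (1/2) x) - max 0 (min (1/2) (x - 1/2)) = fs_phi x"
    by (auto simp: fs_phi_def max_def min_def)
  then have "dyadic_part (Suc m) (2 * k) t - dyadic_part (Suc m) (2 * k + 1) t = fs_phi x / 2 ^ m"
    unfolding 1 2 by (simp flip: diff_divide_distrib)
  then show ?thesis
    unfolding faber_schauder_eq x_def[symmetric] by (simp add: field_simps flip: sqrt2_power_mult_self)
qed

section \<open>Parseval's identity for Haar functions on dyadic grids\<close>

lemma sum_lessThan_double:
  "(\<Sum>k<2 * n. f k) = (\<Sum>k<n. f (2 * k) + f (2 * k + 1))" for f :: "nat \<Rightarrow> real"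
  by (induction n) auto

lemma sum_dyadic_part: "0 \<le> t \<Longrightarrow> t \<le> 1 \<Longrightarrow> (\<Sum>k<2 ^ n. dyadic_part n k t) = t"
proof (induction n)
  case (Suc n)
  have "(\<Sum>k<2 ^ Suc n. dyadic_part (Suc n) k t) = (\<Sum>k<2 ^ n. dyadic_part n k t)"
    by (simp add: sum_lessThan_double dyadic_part_split[of n])
  then show ?case using Suc by simp
qed (simp add: dyadic_part_def)

text \<open>The increments are, up to a common sign, the Haar coefficients of the indicator of the
  interval between u and v. Levels below N and the constant function span the step functions of
  level N, so this is the squared norm of a projection minus the squared mean. Refining by one level
  is (p + q)^2 + (p - q)^2 = 2 (p^2 + q^2).\<close>

lemma faber_schauder_sum_power2:
  assumes "0 \<le> u" "u \<le> 1" "0 \<le> v" "v \<le> 1"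
  shows "(\<Sum>m<N. \<Sum>k<2 ^ m. (faber_schauder m k v - faber_schauder m k u)\<^sup>2) =
    2 ^ N * (\<Sum>k<2 ^ N. (dyadic_part N k v - dyadic_part N k u)\<^sup>2) - (v - u)\<^sup>2"
proof (induction N)
  case 0
  show ?case using assms by (simp add: dyadic_part_def)
next
  case (Suc N)
  define d where "d = (\<lambda>n k. dyadic_part n k v - dyadic_part n k u)"
  have "(faber_schauder N k v - faber_schauder N k u)\<^sup>2 + 2 ^ N * (d N k)\<^sup>2 =
      2 ^ Suc N * ((d (Suc N) (2 * k))\<^sup>2 + (d (Suc N) (2 * k + 1))\<^sup>2)" for k
  proof -
    have 1: "d N k = d (Suc N) (2 * k) + d (Suc N) (2 * k + 1)"
      unfolding d_def dyadic_part_split[of N] by simp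
    have "faber_schauder N k v - faber_schauder N k u =
        sqrt 2 ^ N * (d (Suc N) (2 * k) - d (Suc N) (2 * k + 1))"
      unfolding faber_schauder_dyadic_part d_def by (simp add: algebra_simps)
    then have 2: "(faber_schauder N k v - faber_schauder N k u)\<^sup>2 =
        2 ^ N * (d (Suc N) (2 * k) - d (Suc N) (2 * k + 1))\<^sup>2"
      by (simp add: power_mult_distrib power2_eq_square sqrt2_power_mult_self)
    show ?thesis unfolding 1 2 by (simp add: power2_eq_square algebra_simps)
  qed
  then have "(\<Sum>k<2 ^ N. (faber_schauder N k v - faber_schauder N k u)\<^sup>2) + 2 ^ N * (\<Sum>k<2 ^ N. (d N k)\<^sup>2) =
      2 ^ Suc N * (\<Sum>k<2 ^ Suc N. (d (Suc N) k)\<^sup>2)"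
    by (simp add: sum_lessThan_double sum_distrib_left flip: sum.distrib)
  then show ?case using Suc by (simp add: d_def)
qed

lemma dyadic_part_grid:
  "dyadic_part N k (real j / 2 ^ N) = (if k < j then 1 / 2 ^ N else 0)"
proof -
  have *: "real j / 2 ^ N - real k / 2 ^ N = (real j - real k) / 2 ^ N"
    by (simp add: diff_divide_distrib)
  have "1 / 2 ^ N \<le> (real j - real k) / 2 ^ N" if "k < j"
    using that by (intro divide_right_mono) auto
  moreover have "(real j - real k) / 2 ^ N \<le> 0" if "\<not> k < j"
    using that by (intro divide_nonpos_pos) auto
  moreover have "(0::real) < 1 / 2 ^ N" by simp
  ultimately show ?thesis unfolding dyadic_part_def * by (smt (verit, best))
qed

text \<open>For u and v in the grid of level N the indicator is itself a step function of level N: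
  every dyadic part is full or empty, and the projection loses nothing.\<close>

lemma faber_schauder_parseval_grid:
  assumes "i \<le> j" "j \<le> 2 ^ N"
  defines "u \<equiv> real i / 2 ^ N" and "v \<equiv> real j / 2 ^ N"
  shows "(\<Sum>m<N. \<Sum>k<2 ^ m. (faber_schauder m k v - faber_schauder m k u)\<^sup>2) = (v - u) - (v - u)\<^sup>2"
proof -
  have j: "real j \<le> 2 ^ N" using assms(2) by (metis of_nat_le_iff of_nat_numeral of_nat_power)
  moreover have "real i \<le> real j" using assms(1) by simp
  ultimately have uv: "0 \<le> u" "u \<le> 1" "0 \<le> v" "v \<le> 1"
    unfolding u_def v_def by (auto simp: divide_simps)
  have "2 ^ N * (dyadic_part N k v - dyadic_part N k u)\<^sup>2 = dyadic_part N k v - dyadic_part N k u" for k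
    unfolding u_def v_def dyadic_part_grid using assms(1) by (auto simp: power2_eq_square)
  then have "2 ^ N * (\<Sum>k<2 ^ N. (dyadic_part N k v - dyadic_part N k u)\<^sup>2) =
      (\<Sum>k<2 ^ N. dyadic_part N k v) - (\<Sum>k<2 ^ N. dyadic_part N k u)"
    by (simp add: sum_distrib_left sum_subtractf)
  then show ?thesis
    unfolding faber_schauder_sum_power2[OF uv] using uv by (simp add: sum_dyadic_part)
qed

lemma faber_schauder_grid_zero:
  assumes "N \<le> m"
  shows "faber_schauder m k (real j / 2 ^ N) = 0"
proof -
  have "(2::real) ^ m = 2 ^ N * 2 ^ (m - N)" using assms by (simp flip: power_add)
  then have "2 ^ m * (real j / 2 ^ N) - real k = of_int (2 ^ (m - N) * int j - int k)" by simp
  then show ?thesis unfolding faber_schauder_eq by (simp only: fs_phi_of_int div_0)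
qed

section \<open>Increments summed over one level and over all levels\<close>

lemma faber_schauder_increment_le:
  assumes "u \<le> v"
  shows "\<bar>faber_schauder m k v - faber_schauder m k u\<bar> \<le>
    sqrt 2 ^ m * (dyadic_part m k v - dyadic_part m k u)"
proof -
  define d where "d = (\<lambda>k. dyadic_part (Suc m) k v - dyadic_part (Suc m) k u)"
  have "0 \<le> d k" for k using assms by (simp add: d_def dyadic_part_mono)
  then have *: "\<bar>d (2 * k) - d (2 * k + 1)\<bar> \<le> d (2 * k) + d (2 * k + 1)"
    by (smt (verit))
  have "faber_schauder m k v - faber_schauder m k u = sqrt 2 ^ m * (d (2 * k) - d (2 * k + 1))"
    unfolding faber_schauder_dyadic_part d_def by (simp add: algebra_simps)
  moreover have "dyadic_part m k v - dyadic_part m k u = d (2 * k) + d (2 * k + 1)"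
    unfolding d_def dyadic_part_split[of m] by simp
  ultimately show ?thesis using * by (simp add: abs_mult mult_left_mono)
qed

text \<open>The slopes at level m have modulus \<open>sqrt 2 ^ m\<close> on non-overlapping
  intervals, whose intersections with [u, v] have total length v - u.\<close>

lemma sum_increments_le_slope:
  assumes "0 \<le> u" "u \<le> v" "v \<le> 1"
  shows "(\<Sum>k<2 ^ m. \<bar>faber_schauder m k v - faber_schauder m k u\<bar>) \<le> sqrt 2 ^ m * (v - u)"
proof -
  have "(\<Sum>k<2 ^ m. \<bar>faber_schauder m k v - faber_schauder m k u\<bar>) \<le>
      (\<Sum>k<2 ^ m. sqrt 2 ^ m * (dyadic_part m k v - dyadic_part m k u))"
    by (intro sum_mono faber_schauder_increment_le assms)
  also have "\<dots> = sqrt 2 ^ m * (v - u)"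
    using assms by (simp add: sum_subtractf sum_dyadic_part flip: sum_distrib_left right_diff_distrib)
  finally show ?thesis .
qed

lemma sum_fs_phi_le: "(\<Sum>k<n. fs_phi (x - real k)) \<le> 1 / 2"
proof (cases "\<exists>k<n. fs_phi (x - real k) \<noteq> 0")
  case True
  then obtain k where k: "k < n" "fs_phi (x - real k) \<noteq> 0" by blast
  have "fs_phi (x - real i) = 0" if "i \<noteq> k" for i
  proof -
    have "real k < x" "x < real k + 1" using k(2) by (auto simp: fs_phi_def max_def min_def split: if_splits)
    moreover have "real i + 1 \<le> real k \<or> real k + 1 \<le> real i" using that by linarith
    ultimately show ?thesis by (auto simp: fs_phi_def max_def min_def)
  qed
  then have "(\<Sum>k<n. fs_phi (x - real k)) = fs_phi (x - real k)"
    using k(1) by (subst sum.remove[of _ k]) auto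
  then show ?thesis using fs_phi_le by simp
qed auto

text \<open>At each of the two points at most one function of level m is nonzero, with value at most
  half of \<open>1 / sqrt 2 ^ m\<close>.\<close>

lemma sum_increments_le_sup:
  "(\<Sum>k<2 ^ m. \<bar>faber_schauder m k v - faber_schauder m k u\<bar>) \<le> 1 / sqrt 2 ^ m"
proof -
  have half: "(\<Sum>k<2 ^ m. faber_schauder m k t) \<le> 1 / 2 / sqrt 2 ^ m" for t
    unfolding faber_schauder_eq sum_divide_distrib[symmetric]
    by (intro divide_right_mono sum_fs_phi_le) simp
  have "(\<Sum>k<2 ^ m. \<bar>faber_schauder m k v - faber_schauder m k u\<bar>) \<le>
      (\<Sum>k<2 ^ m. faber_schauder m k v + faber_schauder m k u)"
    by (intro sum_mono) (smt (verit) faber_schauder_nonneg)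
  also have "\<dots> \<le> 1 / sqrt 2 ^ m"
    unfolding sum.distrib using half[of u] half[of v] by simp
  finally show ?thesis .
qed

text \<open>The constant 4 is 1 / (1 - 3/4), with 1 / sqrt 2 <= 3/4 for the ratio of the geometric
  series.\<close>

lemma sum_sqrt2_power_le: "(\<Sum>p\<le>m. sqrt 2 ^ p) \<le> 4 * sqrt 2 ^ m"
proof (induction m)
  case (Suc m)
  have "4 / 3 \<le> sqrt 2" by (rule real_le_rsqrt) (simp add: power2_eq_square)
  then have "4 / 3 * sqrt 2 ^ m \<le> sqrt 2 * sqrt 2 ^ m" by (rule mult_right_mono) simp
  then have "4 * sqrt 2 ^ m \<le> 3 * (sqrt 2 * sqrt 2 ^ m)" by linarith
  with Suc show ?case unfolding sum.atMost_Suc power_Suc by linarith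
qed simp

lemma sum_inverse_sqrt2_power_le: "(\<Sum>p=q..<n. 1 / sqrt 2 ^ p) \<le> 4 / sqrt 2 ^ q"
proof -
  have "4 / 3 \<le> sqrt 2" by (rule real_le_rsqrt) (simp add: power2_eq_square)
  then have step: "1 / sqrt 2 ^ n + 4 / sqrt 2 ^ Suc n \<le> 4 / sqrt 2 ^ n" for n
    by (simp add: field_simps)
  \<comment> \<open>Adding the tail \<open>4 / sqrt 2 ^ n\<close> strengthens the claim enough for
    induction.\<close>
  have "(\<Sum>p=q..<n. 1 / sqrt 2 ^ p) + 4 / sqrt 2 ^ n \<le> 4 / sqrt 2 ^ q" if "q \<le> n"
    using that
  proof (induction n rule: dec_induct)
    case (step n)
    with \<open>\<And>n. 1 / sqrt 2 ^ n + 4 / sqrt 2 ^ Suc n \<le> 4 / sqrt 2 ^ n\<close>[of n] show ?case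
      by (simp add: sum.atLeastLessThan_Suc del: power_Suc)
  qed simp
  moreover have "0 \<le> 4 / sqrt 2 ^ n" for n by simp
  ultimately show ?thesis by (cases "q \<le> n") (auto simp: add_increasing2 intro: order_trans[rotated])
qed

lemma dyadic_scale:
  fixes h :: real
  assumes "0 < h" "h \<le> 1"
  obtains q where "1 / 2 ^ Suc q < h" "h \<le> 1 / 2 ^ q"
proof -
  define P where "P = (\<lambda>n::nat. 1 / 2 ^ n < h)"
  have ex: "\<exists>n. P n"
    using real_arch_pow_inv[OF assms(1), of "1/2"] by (auto simp: P_def power_one_over)
  have "\<not> P 0" using assms by (simp add: P_def)
  then have "Least P \<noteq> 0" using LeastI_ex[OF ex] by metis
  then obtain q where q: "Least P = Suc q" by (cases "Least P") auto
  have "P (Suc q)" using LeastI_ex[OF ex] q by simp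
  moreover have "\<not> P q" by (rule not_less_Least) (simp add: q)
  ultimately show ?thesis using that by (simp add: P_def)
qed

text \<open>The slope bound grows with m and the sup bound decays; they balance at the level q with
  2^{-q} about v - u. Both geometric sums are dominated by their terms there, each giving 4 * sqrt
  (v - u). The absolute values inside make the estimate valid for all signs and uniform in
  n.\<close>

lemma sum_increments_le_holder:
  assumes uv: "0 \<le> u" "u \<le> v" "v \<le> 1"
  shows "(\<Sum>m<n. \<Sum>k<2 ^ m. \<bar>faber_schauder m k v - faber_schauder m k u\<bar>) \<le> 8 * sqrt (v - u)"
proof (cases "u = v")
  case False
  define S where "S = (\<lambda>m. \<Sum>k<2 ^ m. \<bar>faber_schauder m k v - faber_schauder m k u\<bar>)"
  define h where "h = v - u"
  have h: "0 < h" "h \<le> 1" using uv False by (auto simp: h_def)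
  obtain q where q: "1 / 2 ^ Suc q < h" "h \<le> 1 / 2 ^ q" using dyadic_scale[OF h] .
  have S0: "0 \<le> S m" for m by (auto simp: S_def intro: sum_nonneg)
  have sq: "sqrt (1 / 2 ^ m) = 1 / sqrt 2 ^ m" for m
    by (simp add: real_sqrt_divide real_sqrt_power)
  have le1: "sqrt h \<le> 1 / sqrt 2 ^ q" and le2: "1 / sqrt 2 ^ Suc q \<le> sqrt h"
    using real_sqrt_le_mono[OF q(2)] real_sqrt_le_mono[OF less_imp_le[OF q(1)]] unfolding sq by this+
  \<comment> \<open>Extending the range beyond q makes the same splitting possible for every
    n.\<close>
  have "(\<Sum>m<n. S m) \<le> (\<Sum>m<max n (Suc q). S m)"
    by (intro sum_mono2) (auto simp: S0)
  also have "{..<max n (Suc q)} = {..q} \<union> {Suc q..<max n (Suc q)}" by auto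
  also have "sum S \<dots> = (\<Sum>m\<le>q. S m) + (\<Sum>m=Suc q..<max n (Suc q). S m)"
    by (intro sum.union_disjoint) auto
  also have "\<dots> \<le> (\<Sum>m\<le>q. sqrt 2 ^ m * h) + (\<Sum>m=Suc q..<max n (Suc q). 1 / sqrt 2 ^ m)"
    unfolding S_def h_def by (intro add_mono sum_mono sum_increments_le_slope sum_increments_le_sup uv)
  also have "\<dots> \<le> 4 * sqrt 2 ^ q * h + 4 / sqrt 2 ^ Suc q"
    unfolding sum_distrib_right[symmetric]
    using h by (intro add_mono mult_right_mono sum_sqrt2_power_le sum_inverse_sqrt2_power_le) simp_all
  also have "\<dots> \<le> 4 * sqrt h + 4 * sqrt h"
  proof (intro add_mono)
    have "sqrt 2 ^ q * h = sqrt 2 ^ q * sqrt h * sqrt h" using h by simp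
    also have "\<dots> \<le> 1 * sqrt h"
      using le1 h by (intro mult_right_mono) (auto simp: field_simps)
    finally show "4 * sqrt 2 ^ q * h \<le> 4 * sqrt h" by simp
    show "4 / sqrt 2 ^ Suc q \<le> 4 * sqrt h" using le2 by simp
  qed
  finally show ?thesis by (simp add: S_def h_def)
qed (use assms in simp)

subsection \<open>Quadratic variation of partial sums\<close>

text \<open>The pairs $(m,k)$ with $k < 2^m$ are enumerated by $i + 1 = 2^m + k$.\<close>

definition fs_level :: "nat \<Rightarrow> nat" where "fs_level i = floor_log (Suc i)"
definition fs_position :: "nat \<Rightarrow> nat" where "fs_position i = Suc i - 2 ^ fs_level i"
definition fs_basis :: "nat \<Rightarrow> real \<Rightarrow> real" where
  "fs_basis i = faber_schauder (fs_level i) (fs_position i)"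

lemma fs_level_position:
  assumes "k < 2 ^ m"
  shows "fs_level (2 ^ m - 1 + k) = m" "fs_position (2 ^ m - 1 + k) = k"
proof -
  have *: "Suc (2 ^ m - 1 + k) = 2 ^ m + k" by simp
  let ?l = "floor_log (2 ^ m + k)"
  have 1: "2 ^ ?l \<le> 2 ^ m + k" and 2: "2 ^ m + k < 2 * 2 ^ ?l"
    by (auto intro: floor_log_exp2_le floor_log_exp2_gt)
  from 1 have "(2::nat) ^ ?l < 2 ^ Suc m" using assms by simp
  moreover from 2 have "(2::nat) ^ m < 2 ^ Suc ?l" by simp
  ultimately have "?l < Suc m" "m < Suc ?l" by (auto simp only: power_strict_increasing_iff)
  then show "fs_level (2 ^ m - 1 + k) = m" by (simp add: fs_level_def *)
  then show "fs_position (2 ^ m - 1 + k) = k" by (simp add: fs_position_def *)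
qed

lemma fs_position_less: "fs_position i < 2 ^ fs_level i"
  using floor_log_exp2_gt[of "Suc i"] by (simp add: fs_position_def fs_level_def)

lemma fs_index_less: "i < 2 ^ Suc (fs_level i) - 1"
  using floor_log_exp2_gt[of "Suc i"] by (simp add: fs_level_def)

lemma fs_index_inj:
  assumes "fs_level i = fs_level j" "fs_position i = fs_position j"
  shows "i = j"
proof -
  have "2 ^ fs_level i \<le> Suc i" "2 ^ fs_level j \<le> Suc j"
    by (auto simp: fs_level_def intro: floor_log_exp2_le)
  with assms show ?thesis by (auto simp: fs_position_def)
qed

lemma sum_lessThan_add: "(\<Sum>i<a + b. f i) = (\<Sum>i<a. f i) + (\<Sum>k<b. f (a + k))"
  for f :: "nat \<Rightarrow> real"
  by (induction b) auto

lemma sum_fs_index: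
  fixes f :: "nat \<Rightarrow> nat \<Rightarrow> real"
  shows "(\<Sum>i<2 ^ N - 1. f (fs_level i) (fs_position i)) = (\<Sum>m<N. \<Sum>k<2 ^ m. f m k)"
proof (induction N)
  case (Suc N)
  have "(2::nat) ^ Suc N - 1 = (2 ^ N - 1) + 2 ^ N" by simp
  then have "(\<Sum>i<2 ^ Suc N - 1. f (fs_level i) (fs_position i)) =
      (\<Sum>i<2 ^ N - 1. f (fs_level i) (fs_position i)) +
      (\<Sum>k<2 ^ N. f (fs_level (2 ^ N - 1 + k)) (fs_position (2 ^ N - 1 + k)))"
    by (simp only: sum_lessThan_add)
  also have "(\<Sum>k<2 ^ N. f (fs_level (2 ^ N - 1 + k)) (fs_position (2 ^ N - 1 + k))) = (\<Sum>k<2 ^ N. f N k)"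
    by (intro sum.cong refl) (simp only: lessThan_iff fs_level_position)
  finally show ?case using Suc by simp
qed simp

text \<open>The initial value is dropped because only increments matter. The index i may stop inside
  a level, since the coefficients are revealed one at a time.\<close>

definition fs_path :: "real \<Rightarrow> real \<Rightarrow> (nat \<Rightarrow> real) \<Rightarrow> nat \<Rightarrow> real \<Rightarrow> real" where
  "fs_path a c \<sigma> i t = a * t + c * (\<Sum>j<i. \<sigma> j * fs_basis j t)"

text \<open>\<open>S\<close> stays abstract so that one argument yields both the Hoelder bound and
  the slope bound.\<close>

lemma fs_path_increment_le:
  assumes \<sigma>: "\<And>j. j < i \<Longrightarrow> \<bar>\<sigma> j\<bar> \<le> 1" and i: "i \<le> 2 ^ N - 1" and uv: "u \<le> v"
    and S: "(\<Sum>m<N. \<Sum>k<2 ^ m. \<bar>faber_schauder m k v - faber_schauder m k u\<bar>) \<le> S"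
  shows "\<bar>fs_path a c \<sigma> i v - fs_path a c \<sigma> i u\<bar> \<le> \<bar>a\<bar> * (v - u) + \<bar>c\<bar> * S"
proof -
  have "\<bar>\<Sum>j<i. \<sigma> j * (fs_basis j v - fs_basis j u)\<bar> \<le> (\<Sum>j<i. \<bar>fs_basis j v - fs_basis j u\<bar>)"
    by (rule order_trans[OF sum_abs], rule sum_mono)
      (auto simp: abs_mult intro!: mult_left_le_one_le \<sigma>)
  also have "\<dots> \<le> (\<Sum>j<2 ^ N - 1. \<bar>fs_basis j v - fs_basis j u\<bar>)"
    using i by (intro sum_mono2) auto
  also have "\<dots> \<le> S"
    unfolding fs_basis_def
    using sum_fs_index[of "\<lambda>m k. \<bar>faber_schauder m k v - faber_schauder m k u\<bar>" N] S by simp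
  finally have *: "\<bar>\<Sum>j<i. \<sigma> j * (fs_basis j v - fs_basis j u)\<bar> \<le> S" .
  have "fs_path a c \<sigma> i v - fs_path a c \<sigma> i u =
      a * (v - u) + c * (\<Sum>j<i. \<sigma> j * (fs_basis j v - fs_basis j u))"
    by (simp add: fs_path_def right_diff_distrib sum_subtractf)
  also have "\<bar>\<dots>\<bar> \<le> \<bar>a\<bar> * (v - u) + \<bar>c\<bar> * S"
    using uv * by (intro order_trans[OF abs_triangle_ineq] add_mono)
      (auto simp: abs_mult intro: mult_left_mono)
  finally show ?thesis .
qed

lemma fs_path_holder:
  assumes \<sigma>: "\<And>j. j < i \<Longrightarrow> \<bar>\<sigma> j\<bar> \<le> 1" and uv: "0 \<le> u" "u \<le> v" "v \<le> 1"
  shows "\<bar>fs_path a c \<sigma> i v - fs_path a c \<sigma> i u\<bar> \<le> (\<bar>a\<bar> + 8 * \<bar>c\<bar>) * sqrt (v - u)"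
proof -
  \<comment> \<open>The first i indices lie in the first i levels; this crude count is harmless
    because the Hoelder bound is uniform in the number of levels.\<close>
  have "i \<le> 2 ^ i - 1" using less_exp[of i] by linarith
  then have "\<bar>fs_path a c \<sigma> i v - fs_path a c \<sigma> i u\<bar> \<le> \<bar>a\<bar> * (v - u) + \<bar>c\<bar> * (8 * sqrt (v - u))"
    by (intro fs_path_increment_le[OF \<sigma>] sum_increments_le_holder uv)
  also have "v - u \<le> sqrt (v - u)"
    using uv by (intro real_le_rsqrt) (auto simp: power2_eq_square mult_left_le)
  then have "\<bar>a\<bar> * (v - u) + \<bar>c\<bar> * (8 * sqrt (v - u)) \<le> \<bar>a\<bar> * sqrt (v - u) + \<bar>c\<bar> * (8 * sqrt (v - u))"
    by (intro add_right_mono mult_left_mono) auto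
  finally show ?thesis by (simp add: algebra_simps)
qed

text \<open>No coefficient before i exceeds level \<open>fs_level i\<close>, so the slopes add up
  geometrically; the drift is absorbed because \<open>sqrt 2 ^ fs_level i\<close> is at least
  1.\<close>

lemma fs_path_slope:
  assumes \<sigma>: "\<And>j. j < i \<Longrightarrow> \<bar>\<sigma> j\<bar> \<le> 1" and uv: "0 \<le> u" "u \<le> v" "v \<le> 1"
  shows "\<bar>fs_path a c \<sigma> i v - fs_path a c \<sigma> i u\<bar> \<le> (\<bar>a\<bar> + 4 * \<bar>c\<bar>) * (sqrt 2 ^ fs_level i * (v - u))"
proof -
  let ?N = "Suc (fs_level i)"
  have "(\<Sum>m<?N. \<Sum>k<2 ^ m. \<bar>faber_schauder m k v - faber_schauder m k u\<bar>) \<le>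
      (\<Sum>m\<le>fs_level i. sqrt 2 ^ m * (v - u))"
    unfolding lessThan_Suc_atMost by (intro sum_mono sum_increments_le_slope uv)
  also have "\<dots> \<le> 4 * sqrt 2 ^ fs_level i * (v - u)"
    unfolding sum_distrib_right[symmetric] using uv
    by (intro mult_right_mono sum_sqrt2_power_le) simp
  finally have "\<bar>fs_path a c \<sigma> i v - fs_path a c \<sigma> i u\<bar> \<le>
      \<bar>a\<bar> * (v - u) + \<bar>c\<bar> * (4 * sqrt 2 ^ fs_level i * (v - u))"
    using uv fs_index_less[of i] by (intro fs_path_increment_le[where N = "?N", OF \<sigma>]) auto
  also have "v - u \<le> sqrt 2 ^ fs_level i * (v - u)"
    using uv by (simp add: mult_le_cancel_right1)
  then have "\<bar>a\<bar> * (v - u) + \<bar>c\<bar> * (4 * sqrt 2 ^ fs_level i * (v - u)) \<le>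
      \<bar>a\<bar> * (sqrt 2 ^ fs_level i * (v - u)) + \<bar>c\<bar> * (4 * sqrt 2 ^ fs_level i * (v - u))"
    by (intro add_right_mono mult_left_mono) auto
  finally show ?thesis by (simp add: algebra_simps)
qed

text \<open>Discrete covariation along the nodes \<open>w 0\<close>, ..., \<open>w K\<close>.
  Repeated nodes contribute 0, which makes clamping the nodes to [0, t] harmless.\<close>

definition incr_prod :: "(nat \<Rightarrow> real) \<Rightarrow> nat \<Rightarrow> (real \<Rightarrow> real) \<Rightarrow> (real \<Rightarrow> real) \<Rightarrow> real" where
  "incr_prod w K f g = (\<Sum>j<K. (f (w (Suc j)) - f (w j)) * (g (w (Suc j)) - g (w j)))"

text \<open>The drift is the state before any sign is added, so its cross terms with the series fall
  into the last sum. As signs square to 1, randomness survives only in cross terms, and the weight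
  of each sign involves earlier signs only.\<close>

lemma incr_prod_fs_path:
  assumes "\<And>j. j < i \<Longrightarrow> (\<sigma> j)\<^sup>2 = 1"
  shows "incr_prod w K (fs_path a c \<sigma> i) (fs_path a c \<sigma> i) =
     a\<^sup>2 * (\<Sum>j<K. (w (Suc j) - w j)\<^sup>2) + c\<^sup>2 * (\<Sum>j<i. incr_prod w K (fs_basis j) (fs_basis j)) +
     (\<Sum>j<i. \<sigma> j * (2 * c * incr_prod w K (fs_path a c \<sigma> j) (fs_basis j)))"
  using assms
proof (induction i)
  case 0
  show ?case
    by (simp add: incr_prod_def fs_path_def sum_distrib_left power2_eq_square algebra_simps)
next
  case (Suc i)
  have s: "\<sigma> i * \<sigma> i = 1" using Suc.prems[of i] by (simp add: power2_eq_square)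
  have "(fs_path a c \<sigma> (Suc i) v - fs_path a c \<sigma> (Suc i) u) * (fs_path a c \<sigma> (Suc i) v - fs_path a c \<sigma> (Suc i) u) =
    (fs_path a c \<sigma> i v - fs_path a c \<sigma> i u) * (fs_path a c \<sigma> i v - fs_path a c \<sigma> i u)
    + c\<^sup>2 * ((fs_basis i v - fs_basis i u) * (fs_basis i v - fs_basis i u))
    + \<sigma> i * (2 * c * ((fs_path a c \<sigma> i v - fs_path a c \<sigma> i u) * (fs_basis i v - fs_basis i u)))" (is "?L = ?R") for u v
  proof -
    define Y E where "Y = fs_path a c \<sigma> i v - fs_path a c \<sigma> i u" and "E = fs_basis i v - fs_basis i u"
    have 1: "fs_path a c \<sigma> (Suc i) v - fs_path a c \<sigma> (Suc i) u = Y + c * \<sigma> i * E"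
      by (simp add: Y_def E_def fs_path_def algebra_simps)
    have "(Y + c * \<sigma> i * E) * (Y + c * \<sigma> i * E) = Y * Y + c\<^sup>2 * (\<sigma> i * \<sigma> i) * (E * E) + \<sigma> i * (2 * c * (Y * E))"
      by (simp add: algebra_simps power2_eq_square)
    then show ?thesis unfolding 1 s by (simp add: Y_def E_def)
  qed
  then have "incr_prod w K (fs_path a c \<sigma> (Suc i)) (fs_path a c \<sigma> (Suc i)) =
      incr_prod w K (fs_path a c \<sigma> i) (fs_path a c \<sigma> i) + c\<^sup>2 * incr_prod w K (fs_basis i) (fs_basis i)
      + \<sigma> i * (2 * c * incr_prod w K (fs_path a c \<sigma> i) (fs_basis i))"
    by (simp add: incr_prod_def sum.distrib sum_distrib_left)
  then show ?case using Suc by (simp add: algebra_simps)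
qed

text \<open>By Parseval each gap h contributes exactly h - h^2. The lengths telescope, and the
  squares merge with those of the drift into the factor a^2 - c^2.\<close>

lemma incr_prod_fs_path_grid:
  fixes q :: "nat \<Rightarrow> nat"
  assumes \<sigma>: "\<And>j. j < 2 ^ N - 1 \<Longrightarrow> (\<sigma> j)\<^sup>2 = 1"
    and q: "\<And>j. j < K \<Longrightarrow> q j \<le> q (Suc j)" "\<And>j. j < K \<Longrightarrow> q (Suc j) \<le> 2 ^ N"
  defines "w \<equiv> (\<lambda>j. real (q j) / 2 ^ N)"
  shows "incr_prod w K (fs_path a c \<sigma> (2 ^ N - 1)) (fs_path a c \<sigma> (2 ^ N - 1)) =
     c\<^sup>2 * (w K - w 0) + (a\<^sup>2 - c\<^sup>2) * (\<Sum>j<K. (w (Suc j) - w j)\<^sup>2) +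
     (\<Sum>i<2 ^ N - 1. \<sigma> i * (2 * c * incr_prod w K (fs_path a c \<sigma> i) (fs_basis i)))"
proof -
  have "(\<Sum>i<2 ^ N - 1. incr_prod w K (fs_basis i) (fs_basis i)) =
      (\<Sum>j<K. \<Sum>i<2 ^ N - 1. (fs_basis i (w (Suc j)) - fs_basis i (w j))\<^sup>2)"
    unfolding incr_prod_def power2_eq_square by (rule sum.swap)
  also have "\<dots> = (\<Sum>j<K. (w (Suc j) - w j) - (w (Suc j) - w j)\<^sup>2)"
  proof (intro sum.cong refl)
    fix j assume "j \<in> {..<K}"
    then show "(\<Sum>i<2 ^ N - 1. (fs_basis i (w (Suc j)) - fs_basis i (w j))\<^sup>2) = (w (Suc j) - w j) - (w (Suc j) - w j)\<^sup>2"
      using sum_fs_index[of "\<lambda>m k. (faber_schauder m k (w (Suc j)) - faber_schauder m k (w j))\<^sup>2" N]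
        faber_schauder_parseval_grid[of "q j" "q (Suc j)" N] q[of j]
      by (simp add: w_def fs_basis_def)
  qed
  also have "\<dots> = (w K - w 0) - (\<Sum>j<K. (w (Suc j) - w j)\<^sup>2)"
    by (simp only: sum_subtractf[of _ "\<lambda>j. (w (Suc j) - w j)\<^sup>2"] sum_lessThan_telescope)
  finally have *: "(\<Sum>i<2 ^ N - 1. incr_prod w K (fs_basis i) (fs_basis i)) =
      (w K - w 0) - (\<Sum>j<K. (w (Suc j) - w j)\<^sup>2)" .
  show ?thesis
    using incr_prod_fs_path[of "2 ^ N - 1" \<sigma> w K a c, OF \<sigma>] unfolding * by (simp add: algebra_simps)
qed

section \<open>Deterministic bounds for the martingale increments\<close>

lemma variation_fs_basis_le:
  assumes w: "\<And>j. j < K \<Longrightarrow> w j \<le> w (Suc j)"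
  shows "(\<Sum>j<K. \<bar>faber_schauder m k (w (Suc j)) - faber_schauder m k (w j)\<bar>) \<le> 1 / sqrt 2 ^ m"
proof -
  have "(\<Sum>j<K. \<bar>faber_schauder m k (w (Suc j)) - faber_schauder m k (w j)\<bar>) \<le>
      (\<Sum>j<K. sqrt 2 ^ m * (dyadic_part m k (w (Suc j)) - dyadic_part m k (w j)))"
    by (intro sum_mono faber_schauder_increment_le w) simp
  also have "\<dots> = sqrt 2 ^ m * (dyadic_part m k (w K) - dyadic_part m k (w 0))"
    by (simp add: sum_lessThan_telescope[of "\<lambda>j. dyadic_part m k (w j)"] flip: sum_distrib_left)
  also have "\<dots> \<le> sqrt 2 ^ m * (1 / 2 ^ m)"
    using dyadic_part_le[of m k "w K"] dyadic_part_nonneg[of m k "w 0"] by (intro mult_left_mono) auto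
  also have "\<dots> = 1 / sqrt 2 ^ m" by (simp flip: sqrt2_power_mult_self)
  finally show ?thesis .
qed

text \<open>One factor of each square is bounded by the total variation of a single function; the
  other is summed over k first, where each of the K gaps contributes at most
  \<open>1 / sqrt 2 ^ m\<close>. This gains the decay in m that makes the fine levels
  summable.\<close>

lemma sum_variation_power2_le:
  assumes w: "\<And>j. j < K \<Longrightarrow> w j \<le> w (Suc j)"
  defines "T \<equiv> (\<lambda>m k. \<Sum>j<K. \<bar>faber_schauder m k (w (Suc j)) - faber_schauder m k (w j)\<bar>)"
  shows "(\<Sum>k<2 ^ m. (T m k)\<^sup>2) \<le> real K / 2 ^ m"
proof -
  have T: "0 \<le> T m k" "T m k \<le> 1 / sqrt 2 ^ m" for k
    using variation_fs_basis_le[of K w, OF w] by (auto simp: T_def intro: sum_nonneg)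
  have "(\<Sum>k<2 ^ m. (T m k)\<^sup>2) \<le> (\<Sum>k<2 ^ m. 1 / sqrt 2 ^ m * T m k)"
    unfolding power2_eq_square by (intro sum_mono mult_right_mono T)
  also have "\<dots> = 1 / sqrt 2 ^ m * (\<Sum>j<K. \<Sum>k<2 ^ m. \<bar>faber_schauder m k (w (Suc j)) - faber_schauder m k (w j)\<bar>)"
    unfolding T_def sum_distrib_left[symmetric] by (subst sum.swap) (rule refl)
  also have "\<dots> \<le> 1 / sqrt 2 ^ m * (\<Sum>j<K. 1 / sqrt 2 ^ m)"
    by (intro mult_left_mono sum_mono sum_increments_le_sup) simp
  also have "\<dots> = real K / 2 ^ m" by (simp flip: sqrt2_power_mult_self)
  finally show ?thesis .
qed

lemma sum_two_regimes:
  fixes A B :: real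
  assumes "0 \<le> A" "0 \<le> B"
  shows "(\<Sum>m<N. if m < n then A * 2 ^ m else B / 2 ^ m) \<le> A * 2 ^ n + 2 * B / 2 ^ n"
proof -
  \<comment> \<open>The subtracted remainder carries the induction: it is the part of the bound
    reserved for the levels from N on.\<close>
  have "(\<Sum>m<N. if m < n then A * 2 ^ m else B / 2 ^ m) \<le>
      A * 2 ^ n + 2 * B / 2 ^ n - (if N \<le> n then A * (2 ^ n - 2 ^ N) + 2 * B / 2 ^ n else 2 * B / 2 ^ N)"
  proof (induction N)
    case 0
    show ?case using assms by (simp add: right_diff_distrib)
  next
    case (Suc N)
    consider "N < n" | "N = n" | "n < N" by linarith
    then show ?case using Suc assms by cases (auto simp: algebra_simps)
  qed
  also have "\<dots> \<le> A * 2 ^ n + 2 * B / 2 ^ n"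
    using assms by (auto intro!: add_nonneg_nonneg mult_nonneg_nonneg)
  finally show ?thesis .
qed

text \<open>Below level \<open>n\<close> (the scale of the mesh) the path is controlled by its slope, from level \<open>n\<close>
  on by its 1/2-Hoelder norm; using only the latter would cost an additional logarithm.\<close>

definition increment_bound :: "(nat \<Rightarrow> real) \<Rightarrow> nat \<Rightarrow> nat \<Rightarrow> nat \<Rightarrow> real" where
  "increment_bound w K n i = (if fs_level i < n then 1 / 2 ^ n
     else sqrt (1 / 2 ^ n) * (\<Sum>j<K. \<bar>fs_basis i (w (Suc j)) - fs_basis i (w j)\<bar>))"

text \<open>The largest increment of the path times the variation of the basis function. At a coarse
  level m the slope of the path, of order \<open>sqrt 2 ^ m\<close>, cancels against the variation
  \<open>1 / sqrt 2 ^ m\<close>, leaving the mesh alone.\<close>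

lemma abs_incr_prod_fs_path_le:
  assumes \<sigma>: "\<And>j. j < i \<Longrightarrow> \<bar>\<sigma> j\<bar> \<le> 1"
    and w: "\<And>j. j < K \<Longrightarrow> 0 \<le> w j" "\<And>j. j < K \<Longrightarrow> w j \<le> w (Suc j)" "\<And>j. j < K \<Longrightarrow> w (Suc j) \<le> 1"
    and gap: "\<And>j. j < K \<Longrightarrow> w (Suc j) - w j \<le> 1 / 2 ^ n"
  shows "\<bar>incr_prod w K (fs_path a c \<sigma> i) (fs_basis i)\<bar> \<le> (\<bar>a\<bar> + 8 * \<bar>c\<bar>) * increment_bound w K n i"
proof -
  define H where "H = \<bar>a\<bar> + 8 * \<bar>c\<bar>"
  have H: "0 \<le> H" by (simp add: H_def)
  have main: "\<bar>incr_prod w K (fs_path a c \<sigma> i) (fs_basis i)\<bar> \<le>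
      B * (\<Sum>j<K. \<bar>fs_basis i (w (Suc j)) - fs_basis i (w j)\<bar>)"
    if "\<And>j. j < K \<Longrightarrow> \<bar>fs_path a c \<sigma> i (w (Suc j)) - fs_path a c \<sigma> i (w j)\<bar> \<le> B" for B
    unfolding incr_prod_def sum_distrib_left
    by (rule order_trans[OF sum_abs], rule sum_mono) (auto simp: abs_mult intro: mult_right_mono that)
  show ?thesis
  proof (cases "fs_level i < n")
    case True
    let ?r = "sqrt 2 ^ fs_level i"
    have "\<bar>fs_path a c \<sigma> i (w (Suc j)) - fs_path a c \<sigma> i (w j)\<bar> \<le> H * (?r * (1 / 2 ^ n))" if "j < K" for j
    proof -
      have "\<bar>fs_path a c \<sigma> i (w (Suc j)) - fs_path a c \<sigma> i (w j)\<bar> \<le> (\<bar>a\<bar> + 4 * \<bar>c\<bar>) * (?r * (w (Suc j) - w j))"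
        by (intro fs_path_slope \<sigma> w that)
      also have "\<dots> \<le> H * (?r * (1 / 2 ^ n))"
        using w(2)[OF that] by (intro mult_mono mult_left_mono gap that) (auto simp: H_def)
      finally show ?thesis .
    qed
    then have "\<bar>incr_prod w K (fs_path a c \<sigma> i) (fs_basis i)\<bar> \<le>
        H * (?r * (1 / 2 ^ n)) * (\<Sum>j<K. \<bar>fs_basis i (w (Suc j)) - fs_basis i (w j)\<bar>)"
      by (rule main)
    also have "\<dots> \<le> H * (?r * (1 / 2 ^ n)) * (1 / ?r)"
      unfolding fs_basis_def using H by (intro mult_left_mono variation_fs_basis_le w) auto
    also have "\<dots> = H * (1 / 2 ^ n)" by simp
    finally show ?thesis using True by (simp add: increment_bound_def H_def)
  next
    case False
    have "\<bar>fs_path a c \<sigma> i (w (Suc j)) - fs_path a c \<sigma> i (w j)\<bar> \<le> H * sqrt (1 / 2 ^ n)" if "j < K" for j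
    proof -
      have "\<bar>fs_path a c \<sigma> i (w (Suc j)) - fs_path a c \<sigma> i (w j)\<bar> \<le> H * sqrt (w (Suc j) - w j)"
        unfolding H_def by (intro fs_path_holder \<sigma> w that)
      also have "\<dots> \<le> H * sqrt (1 / 2 ^ n)"
        using H by (intro mult_left_mono real_sqrt_le_mono gap that)
      finally show ?thesis .
    qed
    then show ?thesis using False main[of "H * sqrt (1 / 2 ^ n)"]
      by (simp add: increment_bound_def H_def mult.assoc)
  qed
qed

text \<open>The 7 is 1 + 2 * 3: a coarse level has 2^m squares 4^{-n}, in total at most 2^{-n}; a
  fine level gives at most 2^{-n} K / 2^m, in total at most 2 K 4^{-n} <= 6 * 2^{-n}.\<close>

lemma sum_increment_bound_power2_le:
  assumes w: "\<And>j. j < K \<Longrightarrow> w j \<le> w (Suc j)" and K: "K \<le> 3 * 2 ^ n"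
  shows "(\<Sum>i<2 ^ N - 1. (increment_bound w K n i)\<^sup>2) \<le> 7 / 2 ^ n"
proof -
  define T where "T = (\<lambda>m k. \<Sum>j<K. \<bar>faber_schauder m k (w (Suc j)) - faber_schauder m k (w j)\<bar>)"
  have h: "(sqrt (1 / 2 ^ n))\<^sup>2 = 1 / 2 ^ n" by simp
  have "(\<Sum>i<2 ^ N - 1. (increment_bound w K n i)\<^sup>2) =
      (\<Sum>i<2 ^ N - 1. (\<lambda>m k. if m < n then (1 / 2 ^ n)\<^sup>2 else 1 / 2 ^ n * (T m k)\<^sup>2) (fs_level i) (fs_position i))"
    by (intro sum.cong refl) (simp add: increment_bound_def T_def fs_basis_def power_mult_distrib h del: real_sqrt_divide)
  also have "\<dots> = (\<Sum>m<N. \<Sum>k<2 ^ m. if m < n then (1 / 2 ^ n)\<^sup>2 else 1 / 2 ^ n * (T m k)\<^sup>2)"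
    by (rule sum_fs_index)
  also have "\<dots> \<le> (\<Sum>m<N. if m < n then (1 / 2 ^ n)\<^sup>2 * 2 ^ m else (real K / 2 ^ n) / 2 ^ m)"
  proof (intro sum_mono)
    fix m
    show "(\<Sum>k<2 ^ m. if m < n then (1 / 2 ^ n)\<^sup>2 else 1 / 2 ^ n * (T m k)\<^sup>2) \<le>
        (if m < n then (1 / 2 ^ n)\<^sup>2 * 2 ^ m else (real K / 2 ^ n) / 2 ^ m)"
    proof (cases "m < n")
      case False
      have "1 / 2 ^ n * (\<Sum>k<2 ^ m. (T m k)\<^sup>2) \<le> 1 / 2 ^ n * (real K / 2 ^ m)"
        unfolding T_def using sum_variation_power2_le[of K w, OF w] by (intro mult_left_mono) auto
      with False show ?thesis by (simp add: sum_distrib_left mult.commute)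
    qed simp
  qed
  also have "\<dots> \<le> (1 / 2 ^ n)\<^sup>2 * 2 ^ n + 2 * (real K / 2 ^ n) / 2 ^ n"
    by (intro sum_two_regimes) auto
  also have "\<dots> = 1 / 2 ^ n + 2 * (real K / 2 ^ n) / 2 ^ n"
    by (simp add: power2_eq_square)
  also have "\<dots> \<le> 1 / 2 ^ n + 2 * 3 / 2 ^ n"
  proof (rule add_left_mono, rule divide_right_mono, rule mult_left_mono)
    have "real K \<le> real (3 * 2 ^ n)" using K by (simp only: of_nat_le_iff)
    then show "real K / 2 ^ n \<le> 3" by (simp add: pos_divide_le_eq)
  qed simp_all
  also have "\<dots> = 7 / 2 ^ n" by simp
  finally show ?thesis .
qed

subsection \<open>Concentration\<close>

text \<open>This is cosh x <= exp (x^2 / 2), the case of a fair sign in Hoeffding's lemma: weight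
  1/2 and interval length 2 x. Evenness reduces it to x >= 0.\<close>

lemma exp_plus_exp_minus_le: "exp x + exp (- x) \<le> 2 * exp (x\<^sup>2 / 2)" for x :: real
proof -
  have *: "exp x + exp (- x) \<le> 2 * exp (x\<^sup>2 / 2)" if "0 \<le> x" for x :: real
  proof -
    define y where "y = 1 + 1 / 2 * (exp (2 * x) - 1)"
    have y: "0 < y" by (simp add: y_def add_pos_pos field_simps)
    have "- x + ln y \<le> x\<^sup>2 / 2"
      using Hoeffdings_lemma_aux[of "2 * x" "1 / 2"] that by (simp add: y_def power2_eq_square)
    then have "exp (- x + ln y) \<le> exp (x\<^sup>2 / 2)" by simp
    moreover have "exp (- x + ln y) = exp (- x) * y" using y by (simp add: exp_diff exp_minus field_simps)
    moreover have "2 * (exp (- x) * y) = exp x + exp (- x)"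
      by (simp add: y_def algebra_simps flip: exp_add)
    ultimately show ?thesis by linarith
  qed
  show ?thesis using *[of x] *[of "- x"] by (cases "0 \<le> x") auto
qed

text \<open>Under independent fair signs these outcomes are equally likely, so probabilities become
  counts and conditional expectations become sums over the last coordinate. Extensionality keeps the
  set finite.\<close>

definition sign_vectors :: "nat \<Rightarrow> (nat \<Rightarrow> real) set" where
  "sign_vectors P = {..<P} \<rightarrow>\<^sub>E {- 1, 1}"

lemma finite_sign_vectors: "finite (sign_vectors P)"
  by (simp add: sign_vectors_def finite_PiE)

lemma sign_vectorsD: "\<sigma> \<in> sign_vectors P \<Longrightarrow> i < P \<Longrightarrow> \<sigma> i = - 1 \<or> \<sigma> i = 1"
  by (auto simp: sign_vectors_def dest: PiE_mem)

lemma sum_sign_vectors_Suc: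
  fixes f :: "(nat \<Rightarrow> real) \<Rightarrow> real"
  shows "(\<Sum>\<sigma>\<in>sign_vectors (Suc P). f \<sigma>) = (\<Sum>\<sigma>\<in>sign_vectors P. f (\<sigma>(P := - 1)) + f (\<sigma>(P := 1)))"
proof -
  have "(\<Sum>\<sigma>\<in>sign_vectors (Suc P). f \<sigma>) = (\<Sum>(y, \<sigma>)\<in>{- 1, 1} \<times> sign_vectors P. f (\<sigma>(P := y)))"
    unfolding sign_vectors_def lessThan_Suc PiE_insert_eq
    by (subst sum.reindex[OF inj_combinator]) (auto simp: case_prod_unfold)
  also have "\<dots> = (\<Sum>\<sigma>\<in>sign_vectors P. f (\<sigma>(P := - 1))) + (\<Sum>\<sigma>\<in>sign_vectors P. f (\<sigma>(P := 1)))"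
    by (simp flip: sum.cartesian_product)
  finally show ?thesis by (simp add: sum.distrib)
qed

text \<open>\<open>adapted\<close> makes \<open>g P\<close> independent of the last sign. Averaging
  over that sign turns its factor into cosh (\<theta> g_P), at most exp (\<theta>^2 b_P^2 /
  2).\<close>

lemma rademacher_martingale_exp_le:
  fixes g :: "nat \<Rightarrow> (nat \<Rightarrow> real) \<Rightarrow> real"
  assumes adapted: "\<And>i \<sigma> \<tau>. (\<And>j. j < i \<Longrightarrow> \<sigma> j = \<tau> j) \<Longrightarrow> g i \<sigma> = g i \<tau>"
    and bound: "\<And>i \<sigma>. (\<And>j. j < i \<Longrightarrow> \<bar>\<sigma> j\<bar> \<le> 1) \<Longrightarrow> \<bar>g i \<sigma>\<bar> \<le> b i"
  shows "(\<Sum>\<sigma>\<in>sign_vectors P. exp (\<theta> * (\<Sum>i<P. \<sigma> i * g i \<sigma>))) \<le> 2 ^ P * exp (\<theta>\<^sup>2 / 2 * (\<Sum>i<P. (b i)\<^sup>2))"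
proof (induction P)
  case 0
  show ?case by (simp add: sign_vectors_def)
next
  case (Suc P)
  define S where "S = (\<lambda>\<sigma>. \<Sum>i<P. \<sigma> i * g i \<sigma>)"
  have upd: "(\<Sum>i<Suc P. (\<sigma>(P := y)) i * g i (\<sigma>(P := y))) = S \<sigma> + y * g P \<sigma>" for \<sigma> y
  proof -
    have "g i (\<sigma>(P := y)) = g i \<sigma>" if "i \<le> P" for i
      by (rule adapted) (use that in auto)
    then show ?thesis by (simp add: S_def)
  qed
  have "(\<Sum>\<sigma>\<in>sign_vectors (Suc P). exp (\<theta> * (\<Sum>i<Suc P. \<sigma> i * g i \<sigma>))) =
      (\<Sum>\<sigma>\<in>sign_vectors P. exp (\<theta> * S \<sigma>) * (exp (\<theta> * g P \<sigma>) + exp (- (\<theta> * g P \<sigma>))))"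
    unfolding sum_sign_vectors_Suc upd by (intro sum.cong refl) (simp add: algebra_simps flip: exp_add)
  also have "\<dots> \<le> (\<Sum>\<sigma>\<in>sign_vectors P. exp (\<theta> * S \<sigma>) * (2 * exp (\<theta>\<^sup>2 / 2 * (b P)\<^sup>2)))"
  proof (intro sum_mono mult_left_mono)
    fix \<sigma> assume \<sigma>: "\<sigma> \<in> sign_vectors P"
    have "\<bar>\<sigma> j\<bar> \<le> 1" if "j < P" for j using sign_vectorsD[OF \<sigma> that] by auto
    then have "\<bar>g P \<sigma>\<bar> \<le> b P" by (rule bound)
    then have "(g P \<sigma>)\<^sup>2 \<le> (b P)\<^sup>2" using power_mono[of "\<bar>g P \<sigma>\<bar>" "b P" 2] by simp
    then have "(\<theta> * g P \<sigma>)\<^sup>2 / 2 \<le> \<theta>\<^sup>2 / 2 * (b P)\<^sup>2"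
      by (simp add: power_mult_distrib mult_left_mono)
    then show "exp (\<theta> * g P \<sigma>) + exp (- (\<theta> * g P \<sigma>)) \<le> 2 * exp (\<theta>\<^sup>2 / 2 * (b P)\<^sup>2)"
      using exp_plus_exp_minus_le[of "\<theta> * g P \<sigma>"] by (smt (verit) exp_le_cancel_iff)
  qed simp
  also have "\<dots> = 2 * exp (\<theta>\<^sup>2 / 2 * (b P)\<^sup>2) * (\<Sum>\<sigma>\<in>sign_vectors P. exp (\<theta> * S \<sigma>))"
    by (simp add: sum_distrib_right[symmetric] mult.commute)
  also have "\<dots> \<le> 2 * exp (\<theta>\<^sup>2 / 2 * (b P)\<^sup>2) * (2 ^ P * exp (\<theta>\<^sup>2 / 2 * (\<Sum>i<P. (b i)\<^sup>2)))"
    unfolding S_def using Suc by (intro mult_left_mono) simp_all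
  also have "\<dots> = 2 ^ Suc P * exp (\<theta>\<^sup>2 / 2 * (\<Sum>i<Suc P. (b i)\<^sup>2))"
    by (simp add: distrib_left exp_add)
  finally show ?case .
qed

lemma rademacher_martingale_card_le:
  fixes g :: "nat \<Rightarrow> (nat \<Rightarrow> real) \<Rightarrow> real"
  assumes adapted: "\<And>i \<sigma> \<tau>. (\<And>j. j < i \<Longrightarrow> \<sigma> j = \<tau> j) \<Longrightarrow> g i \<sigma> = g i \<tau>"
    and bound: "\<And>i \<sigma>. (\<And>j. j < i \<Longrightarrow> \<bar>\<sigma> j\<bar> \<le> 1) \<Longrightarrow> \<bar>g i \<sigma>\<bar> \<le> b i"
    and B: "(\<Sum>i<P. (b i)\<^sup>2) \<le> B" "0 < B" and u: "0 \<le> u"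
  shows "real (card {\<sigma>\<in>sign_vectors P. u < \<bar>\<Sum>i<P. \<sigma> i * g i \<sigma>\<bar>}) \<le> 2 * 2 ^ P * exp (- (u\<^sup>2 / (2 * B)))"
proof -
  have one_sided: "real (card {\<sigma>\<in>sign_vectors P. u < (\<Sum>i<P. \<sigma> i * h i \<sigma>)}) \<le> 2 ^ P * exp (- (u\<^sup>2 / (2 * B)))"
    (is "real (card ?A) \<le> _")
    if h: "\<And>i \<sigma> \<tau>. (\<And>j. j < i \<Longrightarrow> \<sigma> j = \<tau> j) \<Longrightarrow> h i \<sigma> = h i \<tau>"
      "\<And>i \<sigma>. (\<And>j. j < i \<Longrightarrow> \<bar>\<sigma> j\<bar> \<le> 1) \<Longrightarrow> \<bar>h i \<sigma>\<bar> \<le> b i" for h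
  proof -
    \<comment> \<open>The minimiser of \<open>\<theta>\<^sup>2 / 2 * B - \<theta> * u\<close>, which
      is the Chernoff exponent.\<close>
    define \<theta> where "\<theta> = u / B"
    have \<theta>: "0 \<le> \<theta>" using B u by (simp add: \<theta>_def)
    have "real (card ?A) * exp (\<theta> * u) = (\<Sum>\<sigma>\<in>?A. exp (\<theta> * u))" by simp
    also have "\<dots> \<le> (\<Sum>\<sigma>\<in>?A. exp (\<theta> * (\<Sum>i<P. \<sigma> i * h i \<sigma>)))"
      using \<theta> by (intro sum_mono) (auto intro!: mult_left_mono)
    also have "\<dots> \<le> (\<Sum>\<sigma>\<in>sign_vectors P. exp (\<theta> * (\<Sum>i<P. \<sigma> i * h i \<sigma>)))"
      by (intro sum_mono2 finite_sign_vectors) auto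
    also have "\<dots> \<le> 2 ^ P * exp (\<theta>\<^sup>2 / 2 * (\<Sum>i<P. (b i)\<^sup>2))"
      by (rule rademacher_martingale_exp_le[OF h])
    also have "\<dots> \<le> 2 ^ P * exp (\<theta>\<^sup>2 / 2 * B)"
      using B by (simp add: mult_left_mono)
    finally have "real (card ?A) \<le> 2 ^ P * exp (\<theta>\<^sup>2 / 2 * B) / exp (\<theta> * u)"
      by (simp add: pos_le_divide_eq)
    also have "\<dots> = 2 ^ P * exp (\<theta>\<^sup>2 / 2 * B - \<theta> * u)" by (simp add: exp_diff)
    also have "\<theta>\<^sup>2 / 2 * B - \<theta> * u = - (u\<^sup>2 / (2 * B))"
      using B by (simp add: \<theta>_def power2_eq_square field_simps)
    finally show ?thesis .
  qed
  \<comment> \<open>The factor s = 1 or s = -1 turns each of the two tails into a one-sided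
    one.\<close>
  let ?A = "\<lambda>s. {\<sigma>\<in>sign_vectors P. u < (\<Sum>i<P. \<sigma> i * (s * g i \<sigma>))}"
  have 1: "real (card (?A 1)) \<le> 2 ^ P * exp (- (u\<^sup>2 / (2 * B)))"
  proof (rule one_sided)
    show "1 * g i \<sigma> = 1 * g i \<tau>" if "\<And>j. j < i \<Longrightarrow> \<sigma> j = \<tau> j" for i \<sigma> \<tau>
      using adapted[of i \<sigma> \<tau>] that by simp
  qed (simp add: bound)
  have 2: "real (card (?A (- 1))) \<le> 2 ^ P * exp (- (u\<^sup>2 / (2 * B)))"
  proof (rule one_sided)
    show "- 1 * g i \<sigma> = - 1 * g i \<tau>" if "\<And>j. j < i \<Longrightarrow> \<sigma> j = \<tau> j" for i \<sigma> \<tau>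
      using adapted[of i \<sigma> \<tau>] that by simp
  qed (simp add: bound)
  have "{\<sigma>\<in>sign_vectors P. u < \<bar>\<Sum>i<P. \<sigma> i * g i \<sigma>\<bar>} \<subseteq> ?A 1 \<union> ?A (- 1)"
    by (auto simp: sum_negf abs_if split: if_splits)
  then have "card {\<sigma>\<in>sign_vectors P. u < \<bar>\<Sum>i<P. \<sigma> i * g i \<sigma>\<bar>} \<le> card (?A 1 \<union> ?A (- 1))"
    by (intro card_mono) (auto simp: finite_sign_vectors)
  also have "\<dots> \<le> card (?A 1) + card (?A (- 1))" by (rule card_Un_le)
  finally show ?thesis using 1 2 by linarith
qed

section \<open>From counting sign vectors to probabilities\<close>

lemma (in prob_space) prob_sign_vector:
  assumes indep: "indep_vars (\<lambda>_. borel) X I" and f: "inj f" "range f \<subseteq> I"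
    and p: "\<And>i. i \<in> I \<Longrightarrow> prob {\<omega> \<in> space M. X i \<omega> = 1} = 1 / 2"
      "\<And>i. i \<in> I \<Longrightarrow> prob {\<omega> \<in> space M. X i \<omega> = - 1} = 1 / 2"
    and \<sigma>: "\<sigma> \<in> sign_vectors P"
  shows "prob {\<omega> \<in> space M. \<forall>i<P. X (f i) \<omega> = (\<sigma> i :: real)} = 1 / 2 ^ P"
proof (cases "P = 0")
  \<comment> \<open>The product formula ranges over a nonempty set of indices of X, hence the case
    split, and hence the prescribed signs are pulled back along the inverse of f.\<close>
  case False
  have inj: "inj_on f {..<P}" using f(1) by (rule inj_on_subset) simp
  have "{\<omega> \<in> space M. \<forall>i<P. X (f i) \<omega> = \<sigma> i} =
      (\<Inter>x\<in>f ` {..<P}. X x -` {\<sigma> (the_inv_into {..<P} f x)} \<inter> space M)"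
    using False inj by (auto simp: the_inv_into_f_f)
  also have "prob \<dots> = (\<Prod>x\<in>f ` {..<P}. prob (X x -` {\<sigma> (the_inv_into {..<P} f x)} \<inter> space M))"
    using False f(2) by (intro indep_varsD[OF indep]) auto
  also have "\<dots> = (\<Prod>i<P. prob (X (f i) -` {\<sigma> i} \<inter> space M))"
    using inj by (simp add: prod.reindex the_inv_into_f_f)
  also have "\<dots> = (\<Prod>i<P. 1 / 2)"
  proof (intro prod.cong refl)
    fix i assume "i \<in> {..<P}"
    then have "\<sigma> i = - 1 \<or> \<sigma> i = 1" using sign_vectorsD[OF \<sigma>] by simp
    moreover have "X (f i) -` {y} \<inter> space M = {\<omega> \<in> space M. X (f i) \<omega> = y}" for y by auto
    moreover have "f i \<in> I" using f(2) by auto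
    ultimately show "prob (X (f i) -` {\<sigma> i} \<inter> space M) = 1 / 2" using p by auto
  qed
  finally show ?thesis by (simp add: power_one_over)
qed (simp add: prob_space)

text \<open>Transfers counting estimates to M: the event is a finite union of cylinders, each of
  probability 2^{-P}.\<close>

lemma (in prob_space) sign_vector_event:
  assumes meas [measurable]: "\<And>i. \<eta> i \<in> borel_measurable M"
    and unif: "\<And>P \<sigma>. \<sigma> \<in> sign_vectors P \<Longrightarrow> prob {\<omega> \<in> space M. \<forall>i<P. \<eta> i \<omega> = \<sigma> i} = 1 / 2 ^ P"
    and B: "B \<subseteq> sign_vectors P"
  defines "E \<equiv> {\<omega> \<in> space M. restrict (\<lambda>i. \<eta> i \<omega> :: real) {..<P} \<in> B}"
  shows "E \<in> events" "prob E \<le> real (card B) / 2 ^ P"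
proof -
  have fin: "finite B" using B finite_sign_vectors finite_subset by blast
  have eq: "restrict (\<lambda>i. \<eta> i \<omega>) {..<P} = \<sigma> \<longleftrightarrow> (\<forall>i<P. \<eta> i \<omega> = \<sigma> i)" if "\<sigma> \<in> B" for \<sigma> \<omega>
  proof -
    have "\<sigma> \<in> extensional {..<P}" using that B by (auto simp: sign_vectors_def PiE_def)
    then show ?thesis
      by (auto simp: restrict_def extensional_def fun_eq_iff)
  qed
  have E: "E = (\<Union>\<sigma>\<in>B. {\<omega> \<in> space M. \<forall>i<P. \<eta> i \<omega> = \<sigma> i})"
  proof -
    have "restrict (\<lambda>i. \<eta> i \<omega>) {..<P} \<in> B \<longleftrightarrow> (\<exists>\<sigma>\<in>B. \<forall>i<P. \<eta> i \<omega> = \<sigma> i)" for \<omega>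
    proof -
      have "restrict (\<lambda>i. \<eta> i \<omega>) {..<P} \<in> B \<longleftrightarrow> (\<exists>\<sigma>\<in>B. restrict (\<lambda>i. \<eta> i \<omega>) {..<P} = \<sigma>)" by blast
      also have "\<dots> \<longleftrightarrow> (\<exists>\<sigma>\<in>B. \<forall>i<P. \<eta> i \<omega> = \<sigma> i)" by (intro bex_cong refl eq)
      finally show ?thesis .
    qed
    then show ?thesis by (auto simp: E_def)
  qed
  have meas: "{\<omega> \<in> space M. \<forall>i<P. \<eta> i \<omega> = \<sigma> i} \<in> events" for \<sigma> by measurable
  show "E \<in> events" unfolding E using fin meas by blast
  have "prob E \<le> (\<Sum>\<sigma>\<in>B. prob {\<omega> \<in> space M. \<forall>i<P. \<eta> i \<omega> = \<sigma> i})"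
    unfolding E using fin meas by (intro finite_measure_subadditive_finite) auto
  also have "\<dots> = (\<Sum>\<sigma>\<in>B. 1 / 2 ^ P)"
    using B by (intro sum.cong refl unif) auto
  finally show "prob E \<le> real (card B) / 2 ^ P" by simp
qed

text \<open>The node $s + (k-1) \ell$ clamped to $[0,t]$, in units of the grid, for $\ell$, $s$, $t$ equal to
  \<open>p\<close>, \<open>r\<close>, \<open>j\<close> units. The truncated subtraction performs the clamping at 0.\<close>

definition grid_index :: "nat \<Rightarrow> nat \<Rightarrow> nat \<Rightarrow> nat \<Rightarrow> nat" where
  "grid_index p r j k = min j (r + k * p - p)"

definition grid_node :: "nat \<Rightarrow> nat \<Rightarrow> nat \<Rightarrow> nat \<Rightarrow> nat \<Rightarrow> real" where
  "grid_node N p r j k = real (grid_index p r j k) / 2 ^ N"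

lemma grid_index_props:
  "grid_index p r j k \<le> grid_index p r j (Suc k)" "grid_index p r j k \<le> j"
  "grid_index p r j (Suc k) \<le> grid_index p r j k + p"
  by (auto simp: grid_index_def)

lemma grid_node_props:
  assumes "j \<le> 2 ^ N"
  shows "0 \<le> grid_node N p r j k" "grid_node N p r j k \<le> grid_node N p r j (Suc k)"
    "grid_node N p r j k \<le> 1" "grid_node N p r j (Suc k) - grid_node N p r j k \<le> real p / 2 ^ N"
proof -
  show "0 \<le> grid_node N p r j k" by (simp add: grid_node_def)
  show "grid_node N p r j k \<le> grid_node N p r j (Suc k)"
    using grid_index_props(1) by (auto simp: grid_node_def intro: divide_right_mono)
  have "real (grid_index p r j k) \<le> real (2 ^ N)"
    using order_trans[OF grid_index_props(2) assms] by (simp only: of_nat_le_iff)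
  then show "grid_node N p r j k \<le> 1" by (simp add: grid_node_def)
  have "real (grid_index p r j (Suc k)) - real (grid_index p r j k) \<le> real p"
    using grid_index_props(3)[of p r j k] by linarith
  then show "grid_node N p r j (Suc k) - grid_node N p r j k \<le> real p / 2 ^ N"
    by (auto simp: grid_node_def simp flip: diff_divide_distrib intro: divide_right_mono)
qed

text \<open>Meshes of size about $2^{-n}$ are rounded to the grid $2^{-4n} \mathbb{Z}$: this costs
  $O(2^{-n/2})$ by Hoelder continuity and leaves only $O(2^{12n})$ partitions for the union bound.\<close>

definition fs_martingale :: "real \<Rightarrow> real \<Rightarrow> (nat \<Rightarrow> real) \<Rightarrow> nat \<Rightarrow> nat \<Rightarrow> nat \<Rightarrow> nat \<Rightarrow> real" where
  "fs_martingale a c \<sigma> n p r j = (\<Sum>i<2 ^ (4 * n) - 1. \<sigma> i *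
     (2 * c * incr_prod (grid_node (4 * n) p r j) (2 * 2 ^ n + 1) (fs_path a c \<sigma> i) (fs_basis i)))"

lemma fs_path_cong: "(\<And>j. j < i \<Longrightarrow> \<sigma> j = \<tau> j) \<Longrightarrow> fs_path a c \<sigma> i = fs_path a c \<tau> i"
  by (auto simp: fs_path_def fun_eq_iff)

lemma fs_martingale_cong:
  "(\<And>i. i < 2 ^ (4 * n) - 1 \<Longrightarrow> \<sigma> i = \<tau> i) \<Longrightarrow> fs_martingale a c \<sigma> n p r j = fs_martingale a c \<tau> n p r j"
  unfolding fs_martingale_def by (intro sum.cong refl arg_cong2[where f = "(*)"] arg_cong[where f = "\<lambda>f. incr_prod _ _ f _"] fs_path_cong) auto

text \<open>28 = 4 * 7: the square of the weight \<open>2 * c\<close>, together with the 7 from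
  \<open>sum_increment_bound_power2_le\<close>. Thus \<open>fs_tail a c / 2 ^ n\<close> is the
  variance proxy at mesh 2^{-n}.\<close>

definition fs_tail :: "real \<Rightarrow> real \<Rightarrow> real" where
  "fs_tail a c = 28 * c\<^sup>2 * (\<bar>a\<bar> + 8 * \<bar>c\<bar>)\<^sup>2"

lemma fs_tail_pos: "c \<noteq> 0 \<Longrightarrow> 0 < fs_tail a c"
  by (auto simp: fs_tail_def intro!: mult_pos_pos zero_less_power add_nonneg_pos)

text \<open>The threshold u is chosen so that u^2 / (2 B) = 13 n for the variance proxy B =
  \<open>fs_tail a c / 2 ^ n\<close>. In units of 2^{-4n}, the range of p says that the mesh is at
  most 2^{-n}.\<close>

lemma card_fs_martingale_le:
  assumes c: "c \<noteq> 0" and p: "p \<le> 2 ^ (3 * n)" and j: "j \<le> 2 ^ (4 * n)"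
  defines "P \<equiv> 2 ^ (4 * n) - 1"
  shows "real (card {\<sigma>\<in>sign_vectors P. sqrt (26 * fs_tail a c * real n / 2 ^ n) < \<bar>fs_martingale a c \<sigma> n p r j\<bar>})
    \<le> 2 * 2 ^ P * exp (- (13 * real n))"
proof -
  define w where "w = grid_node (4 * n) p r j"
  \<comment> \<open>A mesh above 2^{-n-1} covers length 1 within 2 * 2^n steps; the additional gap
    is the one between 0 and the shift.\<close>
  define K :: nat where "K = 2 * 2 ^ n + 1"
  define H where "H = \<bar>a\<bar> + 8 * \<bar>c\<bar>"
  define b where "b = (\<lambda>i. 2 * \<bar>c\<bar> * (H * increment_bound w K n i))"
  define u where "u = sqrt (26 * fs_tail a c * real n / 2 ^ n)"
  have w: "0 \<le> w k" "w k \<le> w (Suc k)" "w k \<le> 1" for k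
    using grid_node_props[OF j] by (simp_all add: w_def)
  have "real p \<le> real (2 ^ (3 * n))" using p by (simp only: of_nat_le_iff)
  then have "real p / 2 ^ (4 * n) \<le> 2 ^ (3 * n) / 2 ^ (4 * n)" by (simp add: divide_right_mono)
  also have "\<dots> = 1 / 2 ^ n" by (simp add: field_simps flip: power_add)
  finally have gap: "w (Suc k) - w k \<le> 1 / 2 ^ n" for k
    using grid_node_props(4)[OF j, of p r k] by (simp add: w_def)
  have "real (card {\<sigma>\<in>sign_vectors P. u < \<bar>\<Sum>i<P. \<sigma> i * (2 * c * incr_prod w K (fs_path a c \<sigma> i) (fs_basis i))\<bar>})
      \<le> 2 * 2 ^ P * exp (- (u\<^sup>2 / (2 * (fs_tail a c / 2 ^ n))))"
  proof (rule rademacher_martingale_card_le)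
    show "2 * c * incr_prod w K (fs_path a c \<sigma> i) (fs_basis i) = 2 * c * incr_prod w K (fs_path a c \<tau> i) (fs_basis i)"
      if "\<And>j. j < i \<Longrightarrow> \<sigma> j = \<tau> j" for i \<sigma> \<tau>
      using fs_path_cong[of i \<sigma> \<tau>] that by simp
    show "\<bar>2 * c * incr_prod w K (fs_path a c \<sigma> i) (fs_basis i)\<bar> \<le> b i"
      if "\<And>j. j < i \<Longrightarrow> \<bar>\<sigma> j\<bar> \<le> 1" for i \<sigma>
      using abs_incr_prod_fs_path_le[of i \<sigma> K w n a c, OF that w(1,2,3) gap]
      by (simp add: b_def H_def abs_mult mult_left_mono)
    have "(\<Sum>i<P. (b i)\<^sup>2) = 4 * c\<^sup>2 * H\<^sup>2 * (\<Sum>i<P. (increment_bound w K n i)\<^sup>2)"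
      by (simp add: b_def power_mult_distrib sum_distrib_left mult_ac)
    also have "\<dots> \<le> 4 * c\<^sup>2 * H\<^sup>2 * (7 / 2 ^ n)"
      unfolding P_def by (intro mult_left_mono sum_increment_bound_power2_le w(2)) (simp_all add: K_def)
    also have "\<dots> = fs_tail a c / 2 ^ n" by (simp add: fs_tail_def H_def)
    finally show "(\<Sum>i<P. (b i)\<^sup>2) \<le> fs_tail a c / 2 ^ n" .
    show "0 < fs_tail a c / 2 ^ n" using fs_tail_pos[OF c] by simp
    show "0 \<le> u" using fs_tail_pos[OF c, of a] by (simp add: u_def)
  qed
  also have "u\<^sup>2 / (2 * (fs_tail a c / 2 ^ n)) = 13 * real n"
    using fs_tail_pos[OF c, of a] by (simp add: u_def)
  finally show ?thesis unfolding u_def fs_martingale_def P_def w_def K_def .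
qed

text \<open>There are at most 8 * 2^{12n} triples, each failing on at most a fraction 2 exp (-13 n)
  of the sign vectors. As e >= 2, this leaves 16 * 2^{-n}, which is summable.\<close>

lemma (in prob_space) AE_fs_martingale_le:
  assumes meas: "\<And>i. \<eta> i \<in> borel_measurable M"
    and unif: "\<And>P \<sigma>. \<sigma> \<in> sign_vectors P \<Longrightarrow> prob {\<omega> \<in> space M. \<forall>i<P. \<eta> i \<omega> = \<sigma> i} = 1 / 2 ^ P"
    and c: "c \<noteq> 0" and signs: "AE \<omega> in M. \<forall>i. \<eta> i \<omega> = - 1 \<or> \<eta> i \<omega> = (1::real)"
  shows "AE \<omega> in M. \<forall>\<^sub>F n in sequentially. \<forall>p\<le>2 ^ (3 * n). \<forall>r\<le>2 ^ (4 * n). \<forall>j\<le>2 ^ (4 * n).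
    \<bar>fs_martingale a c (\<lambda>i. \<eta> i \<omega>) n p r j\<bar> \<le> sqrt (26 * fs_tail a c * real n / 2 ^ n)"
proof -
  define P :: "nat \<Rightarrow> nat" where "P = (\<lambda>n. 2 ^ (4 * n) - 1)"
  define I :: "nat \<Rightarrow> (nat \<times> nat \<times> nat) set" where "I = (\<lambda>n. {..2 ^ (3 * n)} \<times> {..2 ^ (4 * n)} \<times> {..2 ^ (4 * n)})"
  define A where "A = (\<lambda>n (p, r, j). {\<sigma>\<in>sign_vectors (P n). sqrt (26 * fs_tail a c * real n / 2 ^ n) < \<bar>fs_martingale a c \<sigma> n p r j\<bar>})"
  define B where "B = (\<lambda>n. \<Union>x\<in>I n. A n x)"
  define E where "E = (\<lambda>n. {\<omega> \<in> space M. restrict (\<lambda>i. \<eta> i \<omega>) {..<P n} \<in> B n})"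
  have sub: "B n \<subseteq> sign_vectors (P n)" for n by (auto simp: B_def A_def)
  have E: "E n \<in> events" "prob (E n) \<le> real (card (B n)) / 2 ^ P n" for n
    using sign_vector_event[of \<eta> "B n" "P n", OF meas unif sub] by (simp_all only: E_def)
  have prob_le: "prob (E n) \<le> 16 * (1 / 2) ^ n" for n
  proof -
    have "card (I n) \<le> (2 * 2 ^ (4 * n)) ^ 3"
    proof -
      have "card (I n) = (2 ^ (3 * n) + 1) * ((2 ^ (4 * n) + 1) * (2 ^ (4 * n) + 1))"
        by (simp add: I_def)
      also have "\<dots> \<le> (2 * 2 ^ (4 * n)) * ((2 * 2 ^ (4 * n)) * (2 * 2 ^ (4 * n)))"
      proof (intro mult_mono)
        have "(2::nat) ^ (3 * n) \<le> 2 ^ (4 * n)" by (intro power_increasing) auto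
        moreover have "(1::nat) \<le> 2 ^ (4 * n)" by simp
        ultimately show "(2::nat) ^ (3 * n) + 1 \<le> 2 * 2 ^ (4 * n)" "(2::nat) ^ (4 * n) + 1 \<le> 2 * 2 ^ (4 * n)"
          "(2::nat) ^ (4 * n) + 1 \<le> 2 * 2 ^ (4 * n)"
          by linarith+
      qed auto
      finally show ?thesis by (simp add: power3_eq_cube)
    qed
    then have I: "real (card (I n)) \<le> real ((2 * 2 ^ (4 * n)) ^ 3)" by (simp only: of_nat_le_iff)
    have "real (card (B n)) \<le> (\<Sum>x\<in>I n. real (card (A n x)))"
      unfolding B_def of_nat_sum[symmetric] of_nat_le_iff by (rule card_UN_le) (simp add: I_def)
    also have "\<dots> \<le> (\<Sum>x\<in>I n. 2 * 2 ^ P n * exp (- (13 * real n)))"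
      using card_fs_martingale_le[OF c] by (intro sum_mono) (auto simp: A_def I_def P_def)
    also have "\<dots> = real (card (I n)) * (2 * 2 ^ P n * exp (- (13 * real n)))" by simp
    also have "\<dots> \<le> real ((2 * 2 ^ (4 * n)) ^ 3) * (2 * 2 ^ P n * exp (- (13 * real n)))"
      by (intro mult_right_mono I) simp
    finally have "real (card (B n)) \<le> real ((2 * 2 ^ (4 * n)) ^ 3) * (2 * 2 ^ P n * exp (- (13 * real n)))" .
    then have "real (card (B n)) / 2 ^ P n \<le> real ((2 * 2 ^ (4 * n)) ^ 3) * (2 * exp (- (13 * real n)))"
      by (simp add: pos_divide_le_eq mult_ac)
    with E(2)[of n] have "prob (E n) \<le> real ((2 * 2 ^ (4 * n)) ^ 3) * (2 * exp (- (13 * real n)))"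
      by (rule order_trans)
    also have "real ((2 * 2 ^ (4 * n)) ^ 3) = 8 * (2 ^ 12) ^ n"
      using power_mult[of "2::real" 12 n] by (simp add: power_mult_distrib flip: power_mult)
    also have "8 * (2 ^ 12) ^ n * (2 * exp (- (13 * real n))) = 16 * ((2 ^ 12) ^ n * exp (- (13 * real n)))"
      by simp
    also have "exp (- (13 * real n)) = (exp (- 1) ^ 13) ^ n"
      by (simp flip: exp_of_nat_mult)
    also have "(exp (- 1) ^ 13) ^ n \<le> ((1 / 2 :: real) ^ 13) ^ n"
    proof (intro power_mono)
      have "2 \<le> exp (1::real)" using exp_ge_add_one_self[of 1] by simp
      then show "exp (- 1) \<le> (1 / 2 :: real)" by (simp add: exp_minus field_simps)
    qed auto
    then have "16 * ((2 ^ 12) ^ n * (exp (- 1) ^ 13) ^ n) \<le> 16 * ((2 ^ 12) ^ n * ((1 / 2 :: real) ^ 13) ^ n)"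
      by (intro mult_left_mono) auto
    also have "(2 ^ 12) ^ n * ((1 / 2 :: real) ^ 13) ^ n = (1 / 2) ^ n"
      unfolding power_mult_distrib[symmetric] by (rule arg_cong[where f = "\<lambda>x. x ^ n"]) (simp add: power_divide)
    finally show ?thesis .
  qed
  have "AE \<omega> in M. \<forall>\<^sub>F n in sequentially. \<omega> \<in> space M - E n"
  proof (rule borel_cantelli_AE1)
    show "summable (\<lambda>n. prob (E n))"
    proof (rule summable_comparison_test')
      show "summable (\<lambda>n. 16 * (1 / 2 :: real) ^ n)" by (intro summable_mult summable_geometric) simp
      show "norm (prob (E n)) \<le> 16 * (1 / 2) ^ n" if "0 \<le> n" for n using prob_le[of n] by simp
    qed
  qed (auto simp: E emeasure_eq_measure)
  with signs show ?thesis
  proof eventually_elim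
    case (elim \<omega>)
    from elim(2) show ?case
    proof eventually_elim
      case (elim n)
      show ?case
      proof (intro allI impI)
        fix p r j :: nat assume prj: "p \<le> 2 ^ (3 * n)" "r \<le> 2 ^ (4 * n)" "j \<le> 2 ^ (4 * n)"
        let ?\<sigma> = "restrict (\<lambda>i. \<eta> i \<omega>) {..<P n}"
        have "?\<sigma> \<in> sign_vectors (P n)"
          using \<open>\<forall>i. \<eta> i \<omega> = - 1 \<or> \<eta> i \<omega> = 1\<close> by (auto simp: sign_vectors_def)
        moreover have "?\<sigma> \<notin> A n (p, r, j)" using elim prj by (auto simp: E_def B_def I_def)
        ultimately have "\<bar>fs_martingale a c ?\<sigma> n p r j\<bar> \<le> sqrt (26 * fs_tail a c * real n / 2 ^ n)"
          by (simp add: A_def not_less)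
        also have "fs_martingale a c ?\<sigma> n p r j = fs_martingale a c (\<lambda>i. \<eta> i \<omega>) n p r j"
          by (rule fs_martingale_cong) (simp add: P_def)
        finally show "\<bar>fs_martingale a c (\<lambda>i. \<eta> i \<omega>) n p r j\<bar> \<le> sqrt (26 * fs_tail a c * real n / 2 ^ n)" .
      qed
    qed
  qed
qed

subsection \<open>Discretisation of the partitions\<close>

text \<open>Allows a partition to be enumerated by a clamped formula instead of its sorted list,
  since repeated nodes contribute 0.\<close>

lemma quad_var_image:
  assumes "\<And>k. k < K \<Longrightarrow> w k \<le> w (Suc k)"
  shows "quad_var (w ` {..K}) x t = (\<Sum>k<K. (x (min (w (Suc k)) t) - x (min (w k) t))\<^sup>2)"
proof -
  \<comment> \<open>The two additional conjuncts identify the last entry of the sorted list: the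
    next node either repeats it or is appended behind it.\<close>
  have "(\<forall>u\<in>w ` {..K}. u \<le> w K) \<and> sorted_list_of_set (w ` {..K}) ! (card (w ` {..K}) - 1) = w K \<and>
      quad_var (w ` {..K}) x t = (\<Sum>k<K. (x (min (w (Suc k)) t) - x (min (w k) t))\<^sup>2)"
    using assms
  proof (induction K)
    case 0
    show ?case by (simp add: quad_var_def)
  next
    case (Suc K)
    define A where "A = w ` {..K}"
    define v where "v = w (Suc K)"
    have A: "\<forall>u\<in>A. u \<le> w K" "sorted_list_of_set A ! (card A - 1) = w K"
      and IH: "quad_var A x t = (\<Sum>k<K. (x (min (w (Suc k)) t) - x (min (w k) t))\<^sup>2)"
      using Suc by (auto simp: A_def)
    have v: "w K \<le> v" using Suc.prems by (simp add: v_def)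
    have ins: "w ` {..Suc K} = insert v A" by (auto simp: A_def v_def atMost_Suc)
    have fin: "finite A" and mem: "w K \<in> A" by (auto simp: A_def)
    have "\<forall>u\<in>insert v A. u \<le> v" using A(1) v by force
    moreover have "sorted_list_of_set (insert v A) ! (card (insert v A) - 1) = v \<and>
        quad_var (insert v A) x t = quad_var A x t + (x (min v t) - x (min (w K) t))\<^sup>2"
    proof (cases "v = w K")
      case True
      then have "insert v A = A" using mem by auto
      then show ?thesis using A(2) True by simp
    next
      case False
      then have new: "v \<notin> A" using A(1) v by auto
      have pos: "0 < card A" using fin mem card_gt_0_iff by blast
      then obtain c where c: "card A = Suc c" by (cases "card A") auto
      have len: "length (sorted_list_of_set A) = Suc c" using c by simp
      have "sorted_list_of_set (insert v A) = insort v (sorted_list_of_set A)"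
        using fin new by (simp add: sorted_list_of_set_insert)
      also have "\<dots> = sorted_list_of_set A @ [v]"
        using A(1) v fin by (intro sorted_insort_is_snoc) force+
      finally have sl: "sorted_list_of_set (insert v A) = sorted_list_of_set A @ [v]" .
      have "card (insert v A) = Suc (Suc c)" using fin new c by simp
      then show ?thesis
        using A(2) c len by (simp add: quad_var_def sl nth_append Let_def power2_abs)
    qed
    ultimately show ?case unfolding ins using IH by (simp add: v_def)
  qed
  then show ?thesis by simp
qed

text \<open>The index is shifted by one: k = 0 gives s - l < 0, clamped to 0, and k =
  \<open>Suc K\<close> gives s + K l >= 1, clamped to 1, so both endpoints appear without special
  treatment.\<close>

lemma shifted_grid_image:
  assumes l: "0 < l" and s: "0 \<le> s" "s < l" and K: "1 \<le> s + real K * l"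
  shows "shifted_grid l s = (\<lambda>k. max 0 (min 1 (s + (real k - 1) * l))) ` {..Suc K}"
proof (intro equalityI subsetI)
  fix y assume "y \<in> shifted_grid l s"
  then consider "y = 0" | "y = 1" | z :: int where "y = s + of_int z * l" "0 < y" "y < 1"
    by (auto simp: shifted_grid_def)
  then show "y \<in> (\<lambda>k. max 0 (min 1 (s + (real k - 1) * l))) ` {..Suc K}"
  proof cases
    case 1
    then show ?thesis using s by (intro image_eqI[of _ _ 0]) auto
  next
    case 2
    then show ?thesis using K by (intro image_eqI[of _ _ "Suc K"]) auto
  next
    case 3
    have "- 1 * l < of_int z * l" using 3 s by linarith
    then have "- 1 < (of_int z :: real)" using l by (simp only: mult_less_cancel_right_pos)
    moreover have "of_int z * l < real K * l" using 3 K by linarith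
    then have "of_int z < real K" using l by (simp only: mult_less_cancel_right_pos)
    ultimately have "- 1 < z" "z < int K" by linarith+
    then show ?thesis using 3 by (intro image_eqI[of _ _ "nat (z + 1)"]) auto
  qed
next
  fix y assume "y \<in> (\<lambda>k. max 0 (min 1 (s + (real k - 1) * l))) ` {..Suc K}"
  then obtain k where y: "y = max 0 (min 1 (s + (real k - 1) * l))" by blast
  have "real k - 1 = of_int (int k - 1)" by simp
  then show "y \<in> shifted_grid l s"
    unfolding shifted_grid_def y by (auto simp: max_def min_def intro!: exI[of _ "int k - 1"])
qed

lemma quad_var_shifted_grid:
  assumes l: "0 < l" and s: "0 \<le> s" "s < l" and K: "1 \<le> s + real K * l" and t: "0 \<le> t" "t \<le> 1"
  defines "y \<equiv> (\<lambda>k. max 0 (min t (s + (real k - 1) * l)))"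
  shows "quad_var (shifted_grid l s) x t = (\<Sum>k<Suc K. (x (y (Suc k)) - x (y k))\<^sup>2)"
proof -
  let ?w = "\<lambda>k. max 0 (min 1 (s + (real k - 1) * l))"
  have "?w k \<le> ?w (Suc k)" for k
    using l by (intro max.mono min.mono order_refl) (simp add: algebra_simps)
  then have "quad_var (shifted_grid l s) x t =
      (\<Sum>k<Suc K. (x (min (?w (Suc k)) t) - x (min (?w k) t))\<^sup>2)"
    unfolding shifted_grid_image[OF l s K] by (intro quad_var_image)
  moreover have "min (?w k) t = y k" for k using t by (auto simp: y_def max_def min_def)
  ultimately show ?thesis by (simp only:)
qed

text \<open>Uses A^2 - B^2 = (A - B) (A + B): the first factor is small because the nodes are close,
  the second is bounded crudely by 2 H. The loss is affordable because e is of order 2^{-3n} in the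
  application.\<close>

lemma quad_sum_perturbation:
  assumes x: "\<And>u v. 0 \<le> u \<Longrightarrow> u \<le> 1 \<Longrightarrow> 0 \<le> v \<Longrightarrow> v \<le> 1 \<Longrightarrow> \<bar>x v - x u\<bar> \<le> H * sqrt \<bar>v - u\<bar>"
    and H: "0 \<le> H"
    and y: "\<And>k. k \<le> K \<Longrightarrow> 0 \<le> y k \<and> y k \<le> 1" and w: "\<And>k. k \<le> K \<Longrightarrow> 0 \<le> w k \<and> w k \<le> 1"
    and yw: "\<And>k. k \<le> K \<Longrightarrow> \<bar>y k - w k\<bar> \<le> e"
  shows "\<bar>(\<Sum>k<K. (x (y (Suc k)) - x (y k))\<^sup>2) - (\<Sum>k<K. (x (w (Suc k)) - x (w k))\<^sup>2)\<bar>
    \<le> real K * (4 * H\<^sup>2 * sqrt e)"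
proof -
  have "\<bar>(x (y (Suc k)) - x (y k))\<^sup>2 - (x (w (Suc k)) - x (w k))\<^sup>2\<bar> \<le> 4 * H\<^sup>2 * sqrt e" if "k < K" for k
  proof -
    define A B where "A = x (y (Suc k)) - x (y k)" and "B = x (w (Suc k)) - x (w k)"
    have near: "\<bar>x (y i) - x (w i)\<bar> \<le> H * sqrt e" if "i \<le> K" for i
    proof -
      have "\<bar>x (y i) - x (w i)\<bar> \<le> H * sqrt \<bar>y i - w i\<bar>" using y[OF that] w[OF that] by (intro x) auto
      also have "\<dots> \<le> H * sqrt e" using H yw[OF that] by (intro mult_left_mono real_sqrt_le_mono)
      finally show ?thesis .
    qed
    have bounded: "\<bar>x v - x u\<bar> \<le> H" if "0 \<le> u" "u \<le> 1" "0 \<le> v" "v \<le> 1" for u v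
    proof -
      have "sqrt \<bar>v - u\<bar> \<le> 1" using that by auto
      then show ?thesis using x[OF that] H mult_left_le order_trans by blast
    qed
    have "\<bar>A - B\<bar> \<le> 2 * H * sqrt e"
      using near[of k] near[of "Suc k"] that by (auto simp: A_def B_def)
    moreover have "\<bar>A + B\<bar> \<le> 2 * H"
      using bounded[of "y k" "y (Suc k)"] bounded[of "w k" "w (Suc k)"] y w that
      by (auto simp: A_def B_def)
    ultimately have "\<bar>A - B\<bar> * \<bar>A + B\<bar> \<le> (2 * H * sqrt e) * (2 * H)"
      by (intro mult_mono) auto
    moreover have "\<bar>A\<^sup>2 - B\<^sup>2\<bar> = \<bar>A - B\<bar> * \<bar>A + B\<bar>"
      by (simp add: power2_eq_square algebra_simps flip: abs_mult)
    moreover have "(2 * H * sqrt e) * (2 * H) = 4 * H\<^sup>2 * sqrt e" by (simp add: power2_eq_square)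
    ultimately show ?thesis by (simp add: A_def B_def)
  qed
  then have "(\<Sum>k<K. \<bar>(x (y (Suc k)) - x (y k))\<^sup>2 - (x (w (Suc k)) - x (w k))\<^sup>2\<bar>) \<le> (\<Sum>k<K. 4 * H\<^sup>2 * sqrt e)"
    by (intro sum_mono) simp
  then show ?thesis by (simp flip: sum_subtractf) (rule order_trans[OF sum_abs])
qed

lemma real_grid_index:
  "real (grid_index p r j k) = max 0 (min (real j) (real r + (real k - 1) * real p))"
proof -
  have "real (r + k * p - p) = max 0 (real r + (real k - 1) * real p)"
    by (cases "p \<le> r + k * p") (auto simp: of_nat_diff algebra_simps max_def simp flip: of_nat_mult of_nat_add)
  then show ?thesis
    unfolding grid_index_def of_nat_min by (auto simp: max_def min_def)
qed

lemma grid_node_eq: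
  "grid_node N p r j k =
     max 0 (min (real j / 2 ^ N) (real r / 2 ^ N + (real k - 1) * (real p / 2 ^ N)))"
proof -
  have scale: "max 0 (min a b) / q = max 0 (min (a / q) (b / q))" if "0 < q" for a b q :: real
    using that by (auto simp: max_def min_def divide_le_cancel zero_le_divide_iff)
  show ?thesis
    unfolding grid_node_def real_grid_index by (subst scale) (auto simp: add_divide_distrib)
qed

lemma max_min_lipschitz:
  fixes t t' b b' e :: real
  assumes "\<bar>t - t'\<bar> \<le> e" "\<bar>b - b'\<bar> \<le> e"
  shows "\<bar>max 0 (min t b) - max 0 (min t' b')\<bar> \<le> e"
  using assms by (auto simp: max_def min_def)

lemma round_down:
  fixes z :: real
  assumes "0 \<le> z"
  obtains p :: nat where "real p / 2 ^ N \<le> z" "z - real p / 2 ^ N \<le> 1 / 2 ^ N"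
proof -
  define p where "p = nat \<lfloor>z * 2 ^ N\<rfloor>"
  have p: "real p \<le> z * 2 ^ N" "z * 2 ^ N \<le> real p + 1" using assms by (auto simp: p_def)
  then have "real p / 2 ^ N \<le> z" "z \<le> (real p + 1) / 2 ^ N"
    by (simp_all add: pos_divide_le_eq pos_le_divide_eq)
  then show ?thesis by (intro that[of p]) (auto simp: add_divide_distrib)
qed

text \<open>At rounded nodes the decomposition is exact, so the errors are the rounding itself, the
  correction (a^2 - c^2) times the sum of squared gaps, the displacement of the two end nodes, and
  the martingale. The 9 is 1 from the correction plus 8 from the ends.\<close>

lemma quad_var_shifted_grid_estimate:
  fixes a c H U :: real
  assumes x: "\<And>u v. 0 \<le> u \<Longrightarrow> u \<le> 1 \<Longrightarrow> 0 \<le> v \<Longrightarrow> v \<le> 1 \<Longrightarrow> \<bar>x v - x u\<bar> \<le> H * sqrt \<bar>v - u\<bar>"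
    and H: "0 \<le> H"
    and grid: "\<And>N j. j \<le> 2 ^ N \<Longrightarrow> x (real j / 2 ^ N) = x 0 + fs_path a c \<sigma> (2 ^ N - 1) (real j / 2 ^ N)"
    and \<sigma>: "\<And>i. (\<sigma> i)\<^sup>2 = 1"
    and U: "\<And>p r j. p \<le> 2 ^ (3 * n) \<Longrightarrow> r \<le> 2 ^ (4 * n) \<Longrightarrow> j \<le> 2 ^ (4 * n) \<Longrightarrow> \<bar>fs_martingale a c \<sigma> n p r j\<bar> \<le> U"
    and l: "1 / 2 ^ Suc n < l" "l \<le> 1 / 2 ^ n" and s: "0 \<le> s" "s < l" and t: "0 \<le> t" "t \<le> 1"
  shows "\<bar>quad_var (shifted_grid l s) x t - c\<^sup>2 * t\<bar> \<le> 24 * H\<^sup>2 * sqrt (1 / 2 ^ n) + (a\<^sup>2 + 9 * c\<^sup>2) / 2 ^ n + U"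
proof -
  define K :: nat where "K = 2 * 2 ^ n"
  define N where "N = 4 * n"
  define y where "y = (\<lambda>k. max 0 (min t (s + (real k - 1) * l)))"
  define q :: real where "q = 2 ^ n"
  have q: "1 \<le> q" and qN: "2 ^ N = q ^ 4" "2 ^ (3 * n) = q ^ 3" and K_q: "real K = 2 * q"
    by (simp_all add: q_def N_def K_def power_mult mult.commute flip: power_mult)
  have "0 < (1::real) / 2 ^ Suc n" by simp
  then have l0: "0 < l" using l(1) by linarith
  have "1 / q \<le> 1" using q by simp
  then have l1: "l \<le> 1" using l(2) unfolding q_def by (rule order_trans[rotated])
  \<comment> \<open>Rounding down keeps p, r and j within the ranges for which \<open>U\<close> is
    assumed.\<close>
  obtain p where p: "real p / 2 ^ N \<le> l" "l - real p / 2 ^ N \<le> 1 / 2 ^ N"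
    using round_down[of l N] l0 by auto
  obtain r where r: "real r / 2 ^ N \<le> s" "s - real r / 2 ^ N \<le> 1 / 2 ^ N"
    using round_down[of s N] s by auto
  obtain j where j: "real j / 2 ^ N \<le> t" "t - real j / 2 ^ N \<le> 1 / 2 ^ N"
    using round_down[of t N] t by auto
  define w where "w = grid_node N p r j"
  have to_nat: "m \<le> 2 ^ i" if "real m \<le> 2 ^ i" for m i :: nat
  proof -
    have "real m \<le> real (2 ^ i)" using that by simp
    then show ?thesis by (simp only: of_nat_le_iff)
  qed
  have "real p \<le> l * 2 ^ N" using p(1) by (simp add: pos_divide_le_eq)
  also have "\<dots> \<le> 1 / q * q ^ 4" using l(2) q unfolding qN by (intro mult_right_mono) (auto simp: q_def)
  also have "\<dots> = q ^ 3" using q by (simp add: power_numeral_reduce)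
  finally have p_le: "p \<le> 2 ^ (3 * n)" using qN by (intro to_nat) simp
  have "real r / 2 ^ N \<le> 1" "real j / 2 ^ N \<le> 1" using r(1) s l1 j(1) t by linarith+
  then have r_le: "r \<le> 2 ^ N" and j_le: "j \<le> 2 ^ N" by (auto intro!: to_nat simp: pos_divide_le_eq)
  note w = grid_node_props[OF j_le, of p r, folded w_def]
  \<comment> \<open>A node moves by the rounding of s plus at most K times that of l, in total (1 +
    2 q) / q^4. The 4, a perfect square, keeps \<open>sqrt e\<close> simple.\<close>
  define e where "e = 4 / q ^ 3"
  have e: "1 / 2 ^ N + real K * (1 / 2 ^ N) \<le> e"
  proof -
    have "1 / 2 ^ N + real K * (1 / 2 ^ N) = (1 + 2 * q) / q ^ 4" by (simp add: qN K_q add_divide_distrib)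
    also have "\<dots> \<le> (4 * q) / q ^ 4" using q by (intro divide_right_mono) auto
    also have "\<dots> = e" using q by (simp add: e_def power_numeral_reduce)
    finally show ?thesis .
  qed
  have near: "\<bar>y k - w k\<bar> \<le> e" if "k \<le> Suc K" for k
    unfolding y_def w_def grid_node_eq
  proof (rule max_min_lipschitz)
    have "\<bar>t - real j / 2 ^ N\<bar> \<le> 1 / 2 ^ N" using j by simp
    also have "\<dots> \<le> e" using e by (rule order_trans[rotated]) simp
    finally show "\<bar>t - real j / 2 ^ N\<bar> \<le> e" .
    have "1 \<le> K" by (simp add: K_def)
    then have k: "\<bar>real k - 1\<bar> \<le> real K" using that by auto
    have "\<bar>s + (real k - 1) * l - (real r / 2 ^ N + (real k - 1) * (real p / 2 ^ N))\<bar> =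
        \<bar>(s - real r / 2 ^ N) + (real k - 1) * (l - real p / 2 ^ N)\<bar>" by (simp add: algebra_simps)
    also have "\<dots> \<le> \<bar>s - real r / 2 ^ N\<bar> + \<bar>real k - 1\<bar> * \<bar>l - real p / 2 ^ N\<bar>"
      by (rule order_trans[OF abs_triangle_ineq]) (simp add: abs_mult)
    also have "\<dots> \<le> 1 / 2 ^ N + real K * (1 / 2 ^ N)"
      using p r k by (intro add_mono mult_mono) auto
    also note e
    finally show "\<bar>s + (real k - 1) * l - (real r / 2 ^ N + (real k - 1) * (real p / 2 ^ N))\<bar> \<le> e" .
  qed
  have Kl: "1 \<le> real K * l"
    using l(1) q by (simp add: K_q q_def[symmetric] field_simps)
  then have V: "quad_var (shifted_grid l s) x t = (\<Sum>k<Suc K. (x (y (Suc k)) - x (y k))\<^sup>2)"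
    unfolding y_def using quad_var_shifted_grid[OF l0 s _ t] s by simp
  have y: "0 \<le> y k \<and> y k \<le> 1" for k using t by (auto simp: y_def)
  have "\<bar>quad_var (shifted_grid l s) x t - (\<Sum>k<Suc K. (x (w (Suc k)) - x (w k))\<^sup>2)\<bar> \<le> real (Suc K) * (4 * H\<^sup>2 * sqrt e)"
    unfolding V using x H y w near by (intro quad_sum_perturbation) auto
  also have "\<dots> \<le> (3 * q) * (4 * H\<^sup>2 * sqrt e)"
    using q by (intro mult_right_mono) (auto simp: K_q e_def)
  also have "sqrt e = 2 / q * sqrt (1 / q)"
    unfolding e_def using q by (intro real_sqrt_unique) (auto simp: power_mult_distrib power_divide power_numeral_reduce)
  also have "(3 * q) * (4 * H\<^sup>2 * (2 / q * sqrt (1 / q))) = 24 * H\<^sup>2 * sqrt (1 / 2 ^ n)"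
    using q by (simp add: q_def)
  finally have 1: "\<bar>quad_var (shifted_grid l s) x t - (\<Sum>k<Suc K. (x (w (Suc k)) - x (w k))\<^sup>2)\<bar> \<le> 24 * H\<^sup>2 * sqrt (1 / 2 ^ n)" .
  have x_w: "x (w k) = x 0 + fs_path a c \<sigma> (2 ^ N - 1) (w k)" for k
    unfolding w_def grid_node_def using grid_index_props(2)[of p r j k] j_le by (intro grid) simp
  have "(\<Sum>k<Suc K. (x (w (Suc k)) - x (w k))\<^sup>2) =
      incr_prod w (Suc K) (fs_path a c \<sigma> (2 ^ N - 1)) (fs_path a c \<sigma> (2 ^ N - 1))"
    unfolding incr_prod_def x_w by (simp add: power2_eq_square)
  also have "\<dots> = c\<^sup>2 * (w (Suc K) - w 0) + (a\<^sup>2 - c\<^sup>2) * (\<Sum>k<Suc K. (w (Suc k) - w k)\<^sup>2) + fs_martingale a c \<sigma> n p r j"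
  proof -
    have q: "grid_index p r j (Suc k) \<le> 2 ^ N" for k
      using grid_index_props(2)[of p r j "Suc k"] j_le by simp
    have *: "Suc K = 2 * 2 ^ n + 1" by (simp add: K_def)
    have w_at: "real (grid_index p r j k) / 2 ^ N = w k" for k by (simp add: w_def grid_node_def)
    show ?thesis
      using incr_prod_fs_path_grid[where \<sigma> = \<sigma> and q = "grid_index p r j" and K = "Suc K" and N = N and a = a and c = c, OF \<sigma> grid_index_props(1) q]
      unfolding fs_martingale_def * N_def[symmetric] w_def[symmetric] w_at .
  qed
  finally have 2: "(\<Sum>k<Suc K. (x (w (Suc k)) - x (w k))\<^sup>2) =
    c\<^sup>2 * (w (Suc K) - w 0) + (a\<^sup>2 - c\<^sup>2) * (\<Sum>k<Suc K. (w (Suc k) - w k)\<^sup>2) + fs_martingale a c \<sigma> n p r j" .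
  define D where "D = (\<Sum>k<Suc K. (w (Suc k) - w k)\<^sup>2)"
  have D: "0 \<le> D" "D \<le> 1 / 2 ^ n"
  proof -
    show "0 \<le> D" unfolding D_def by (rule sum_nonneg) simp
    have "D \<le> (\<Sum>k<Suc K. 1 / 2 ^ n * (w (Suc k) - w k))"
      unfolding D_def power2_eq_square
    proof (intro sum_mono mult_right_mono)
      fix k show "w (Suc k) - w k \<le> 1 / 2 ^ n" using w(4)[of k] p(1) l(2) by linarith
    qed (use w in simp)
    also have "\<dots> = 1 / 2 ^ n * (w (Suc K) - w 0)"
      by (simp only: sum_distrib_left[symmetric] sum_lessThan_telescope)
    also have "\<dots> \<le> 1 / 2 ^ n * 1" using w(1)[of 0] w(3)[of "Suc K"] by (intro mult_left_mono) auto
    finally show "D \<le> 1 / 2 ^ n" by simp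
  qed
  have 3: "\<bar>(a\<^sup>2 - c\<^sup>2) * D\<bar> \<le> (a\<^sup>2 + c\<^sup>2) / 2 ^ n"
  proof -
    have "\<bar>(a\<^sup>2 - c\<^sup>2) * D\<bar> \<le> (a\<^sup>2 + c\<^sup>2) * (1 / 2 ^ n)"
      unfolding abs_mult using D by (intro mult_mono) (auto simp: abs_le_iff)
    then show ?thesis by simp
  qed
  \<comment> \<open>The exact clamped nodes run from 0 to t; each rounded end node is off by at most
    e.\<close>
  have "y (Suc K) = t" "y 0 = 0"
    using Kl s t by (auto simp: y_def max_def min_def)
  then have "\<bar>(w (Suc K) - w 0) - t\<bar> \<le> 2 * e" using near[of 0] near[of "Suc K"] by auto
  also have "\<dots> \<le> 8 / q"
  proof -
    have "q ^ 1 \<le> q ^ 3" using q by (intro power_increasing) auto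
    then have "1 / q ^ 3 \<le> 1 / q" using q by (intro divide_left_mono) auto
    then show ?thesis by (simp add: e_def)
  qed
  finally have "c\<^sup>2 * \<bar>(w (Suc K) - w 0) - t\<bar> \<le> c\<^sup>2 * (8 / q)" by (intro mult_left_mono) auto
  then have 4: "\<bar>c\<^sup>2 * (w (Suc K) - w 0) - c\<^sup>2 * t\<bar> \<le> 8 * c\<^sup>2 / 2 ^ n"
    by (simp add: q_def mult.commute[of 8] abs_mult flip: right_diff_distrib)
  have 5: "\<bar>fs_martingale a c \<sigma> n p r j\<bar> \<le> U" using p_le r_le j_le by (intro U) (auto simp: N_def)
  have "(a\<^sup>2 + 9 * c\<^sup>2) / 2 ^ n = (a\<^sup>2 + c\<^sup>2) / 2 ^ n + 8 * c\<^sup>2 / 2 ^ n" by (simp flip: add_divide_distrib)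
  then show ?thesis using 1 3 4 5 unfolding 2 D_def by linarith
qed

subsection \<open>Almost sure modulus\<close>

lemma abs_sum_coeff_le:
  fixes f e :: "nat \<Rightarrow> real"
  assumes "\<And>k. k < n \<Longrightarrow> \<bar>f k\<bar> \<le> 1"
  shows "\<bar>\<Sum>k<n. f k * e k\<bar> \<le> (\<Sum>k<n. \<bar>e k\<bar>)"
  by (rule order_trans[OF sum_abs], rule sum_mono)
    (auto simp: abs_mult intro!: mult_left_le_one_le assms)

text \<open>One realisation of the signs. All arguments inside are pathwise; randomness enters only
  through the martingale hypothesis of \<open>Omega2_bound\<close>.\<close>

locale faber_schauder_series =
  fixes f :: "nat \<Rightarrow> nat \<Rightarrow> real" and a c :: real and x :: "real \<Rightarrow> real"
  assumes signs: "\<And>m k. k < 2 ^ m \<Longrightarrow> f m k = - 1 \<or> f m k = 1"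
    and x: "\<And>t. 0 \<le> t \<Longrightarrow> t \<le> 1 \<Longrightarrow> x t = x 0 + a * t + c * (\<Sum>m. \<Sum>k<2 ^ m. f m k * faber_schauder m k t)"
begin

abbreviation "holder_const \<equiv> \<bar>a\<bar> + 8 * \<bar>c\<bar>"

lemma abs_coeff_le: "k < 2 ^ m \<Longrightarrow> \<bar>f m k\<bar> \<le> 1"
  using signs[of k m] by auto

lemma series_summable: "summable (\<lambda>m. \<Sum>k<2 ^ m. f m k * faber_schauder m k t)"
proof (rule summable_comparison_test')
  have "1 < sqrt 2" by simp
  then show "summable (\<lambda>m. (1 / sqrt 2) ^ m)" by (intro summable_geometric) simp
  fix m :: nat
  have "\<bar>\<Sum>k<2 ^ m. f m k * faber_schauder m k t\<bar> \<le> (\<Sum>k<2 ^ m. \<bar>faber_schauder m k t\<bar>)"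
    by (intro abs_sum_coeff_le abs_coeff_le)
  \<comment> \<open>All functions vanish at 0, so their values are increments from 0.\<close>
  also have "\<dots> = (\<Sum>k<2 ^ m. \<bar>faber_schauder m k t - faber_schauder m k 0\<bar>)"
    using faber_schauder_grid_zero[of 0 m _ 0] by simp
  also have "\<dots> \<le> 1 / sqrt 2 ^ m" by (rule sum_increments_le_sup)
  finally show "norm (\<Sum>k<2 ^ m. f m k * faber_schauder m k t) \<le> (1 / sqrt 2) ^ m"
    by (simp add: power_one_over)
qed

text \<open>The bound on increments is uniform in the number of levels and therefore passes to the
  limit.\<close>

lemma path_holder:
  assumes "0 \<le> u" "u \<le> 1" "0 \<le> v" "v \<le> 1"
  shows "\<bar>x v - x u\<bar> \<le> holder_const * sqrt \<bar>v - u\<bar>"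
proof -
  have ordered: "\<bar>x v - x u\<bar> \<le> holder_const * sqrt (v - u)" if uv: "0 \<le> u" "u \<le> v" "v \<le> 1" for u v
  proof -
    define d where "d = (\<lambda>m. \<Sum>k<2 ^ m. f m k * (faber_schauder m k v - faber_schauder m k u))"
    have d: "d = (\<lambda>m. (\<Sum>k<2 ^ m. f m k * faber_schauder m k v) - (\<Sum>k<2 ^ m. f m k * faber_schauder m k u))"
      by (simp add: d_def right_diff_distrib sum_subtractf)
    have sums: "(\<lambda>n. \<Sum>m<n. d m) \<longlonglongrightarrow> suminf d"
      unfolding d by (intro summable_LIMSEQ summable_diff series_summable)
    have "\<bar>\<Sum>m<n. d m\<bar> \<le> 8 * sqrt (v - u)" for n
    proof -
      have "\<bar>\<Sum>m<n. d m\<bar> \<le> (\<Sum>m<n. \<Sum>k<2 ^ m. \<bar>faber_schauder m k v - faber_schauder m k u\<bar>)"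
        unfolding d_def by (rule order_trans[OF sum_abs], intro sum_mono abs_sum_coeff_le abs_coeff_le)
      also have "\<dots> \<le> 8 * sqrt (v - u)" by (intro sum_increments_le_holder uv)
      finally show ?thesis .
    qed
    then have lim: "\<bar>suminf d\<bar> \<le> 8 * sqrt (v - u)"
      by (intro LIMSEQ_le_const2[OF tendsto_rabs[OF sums]]) auto
    have "suminf d = (\<Sum>m. \<Sum>k<2 ^ m. f m k * faber_schauder m k v) - (\<Sum>m. \<Sum>k<2 ^ m. f m k * faber_schauder m k u)"
      unfolding d by (intro suminf_diff[symmetric] series_summable)
    then have "c * suminf d =
        c * (\<Sum>m. \<Sum>k<2 ^ m. f m k * faber_schauder m k v) - c * (\<Sum>m. \<Sum>k<2 ^ m. f m k * faber_schauder m k u)"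
      by (simp only: right_diff_distrib)
    then have "x v - x u = a * (v - u) + c * suminf d"
      using x[of u] x[of v] uv by (simp add: algebra_simps)
    also have "\<bar>\<dots>\<bar> \<le> \<bar>a\<bar> * (v - u) + \<bar>c\<bar> * (8 * sqrt (v - u))"
      using uv lim by (intro order_trans[OF abs_triangle_ineq] add_mono)
        (auto simp: abs_mult intro: mult_left_mono)
    also have "v - u \<le> sqrt (v - u)"
      using uv by (intro real_le_rsqrt) (auto simp: power2_eq_square mult_left_le)
    then have "\<bar>a\<bar> * (v - u) + \<bar>c\<bar> * (8 * sqrt (v - u)) \<le> \<bar>a\<bar> * sqrt (v - u) + \<bar>c\<bar> * (8 * sqrt (v - u))"
      by (intro add_right_mono mult_left_mono) auto
    finally show ?thesis by (simp add: algebra_simps)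
  qed
  show ?thesis using ordered[of u v] ordered[of v u] assms
    by (cases "u \<le> v") (auto simp: abs_minus_commute)
qed

lemma path_continuous: "continuous_on {0..1} x"
  unfolding continuous_on_def
proof
  fix u :: real assume u: "u \<in> {0..1}"
  have "((\<lambda>v. holder_const * sqrt \<bar>v - u\<bar>) \<longlongrightarrow> holder_const * sqrt \<bar>u - u\<bar>) (at u within {0..1})"
    by (intro tendsto_intros)
  then have "((\<lambda>v. holder_const * sqrt \<bar>v - u\<bar>) \<longlongrightarrow> 0) (at u within {0..1})" by simp
  moreover have "\<forall>\<^sub>F v in at u within {0..1}. norm (x v - x u) \<le> holder_const * sqrt \<bar>v - u\<bar>"
    using u by (auto simp: eventually_at_filter intro!: always_eventually path_holder)
  ultimately have "((\<lambda>v. x v - x u) \<longlongrightarrow> 0) (at u within {0..1})" by (rule Lim_null_comparison[rotated])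
  then show "(x \<longlongrightarrow> x u) (at u within {0..1})" by (simp add: LIM_zero_iff)
qed

definition sign_seq :: "nat \<Rightarrow> real" where "sign_seq i = f (fs_level i) (fs_position i)"

lemma sign_seq_power2: "(sign_seq i)\<^sup>2 = 1"
  using signs[OF fs_position_less, of i] by (auto simp: sign_seq_def)

lemma path_grid:
  assumes "j \<le> 2 ^ N"
  shows "x (real j / 2 ^ N) = x 0 + fs_path a c sign_seq (2 ^ N - 1) (real j / 2 ^ N)"
proof -
  let ?t = "real j / 2 ^ N"
  have "real j \<le> real (2 ^ N)" using assms by (simp only: of_nat_le_iff)
  then have t: "0 \<le> ?t" "?t \<le> 1" by (simp_all add: pos_divide_le_eq)
  have "(\<Sum>m. \<Sum>k<2 ^ m. f m k * faber_schauder m k ?t) = (\<Sum>m<N. \<Sum>k<2 ^ m. f m k * faber_schauder m k ?t)"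
    by (intro suminf_finite) (auto simp: faber_schauder_grid_zero)
  also have "\<dots> = (\<Sum>i<2 ^ N - 1. sign_seq i * fs_basis i ?t)"
    unfolding sign_seq_def fs_basis_def using sum_fs_index[of "\<lambda>m k. f m k * faber_schauder m k ?t" N] by simp
  finally show ?thesis using x[OF t] by (simp add: fs_path_def)
qed

end

text \<open>\<open>Omega2\<close> takes a supremum over all meshes up to \<delta>, so the bound must
  be monotone in the mesh. The proof rests on ln y <= y - 1 at y = d / l and on 1 - ln d >=
  1.\<close>

lemma mult_ln_mono:
  fixes l d :: real
  assumes "0 < l" "l \<le> d" "d \<le> 1"
  shows "l * ln (exp 1 / l) \<le> d * ln (exp 1 / d)"
proof -
  have l: "ln (exp 1 / l) = 1 - ln l" and d: "ln (exp 1 / d) = 1 - ln d"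
    using assms by (simp_all add: ln_div)
  have "ln (d / l) \<le> d / l - 1" using assms by (intro ln_le_minus_one) simp
  then have "l * (ln d - ln l) \<le> l * (d / l - 1)"
    using assms by (intro mult_left_mono) (simp_all add: ln_div)
  also have "\<dots> = d - l" using assms by (simp add: field_simps)
  also have "\<dots> \<le> (d - l) * (1 - ln d)"
    using assms by (simp add: mult_le_cancel_left1)
  finally show ?thesis unfolding l d by (simp add: algebra_simps)
qed

text \<open>Trades the dyadic scale for the mesh itself: n <= 2 ln (e / l) because ln 2 >= 1/2, and
  2^{-n} < 2 l.\<close>

lemma dyadic_scale_le:
  fixes l :: real
  assumes l: "1 / 2 ^ Suc n < l" "l \<le> 1 / 2 ^ n"
  shows "real n / 2 ^ n \<le> 4 * (l * ln (exp 1 / l))"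
proof -
  have "0 < (1::real) / 2 ^ Suc n" by simp
  then have l0: "0 < l" using l(1) by linarith
  have "ln l \<le> ln (1 / 2 ^ n)" using l0 l(2) by simp
  also have "\<dots> = - (real n * ln 2)" by (simp add: ln_div ln_realpow)
  also have "\<dots> \<le> - (real n * (1 / 2))"
    using ln2_ge_two_thirds by (intro le_imp_neg_le mult_left_mono) auto
  finally have "real n \<le> 2 * ln (exp 1 / l)" using l0 by (simp add: ln_div)
  moreover have "1 / 2 ^ n \<le> 2 * l" using l(1) by simp
  ultimately have "real n * (1 / 2 ^ n) \<le> (2 * ln (exp 1 / l)) * (2 * l)"
    by (intro mult_mono) (auto intro: order_trans[of _ "real n"])
  then show ?thesis by (simp add: mult_ac)
qed

context faber_schauder_series
begin

lemma Omega2_bound: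
  assumes c: "c \<noteq> 0"
    and ev: "\<forall>\<^sub>F n in sequentially. \<forall>p\<le>2 ^ (3 * n). \<forall>r\<le>2 ^ (4 * n). \<forall>j\<le>2 ^ (4 * n).
      \<bar>fs_martingale a c sign_seq n p r j\<bar> \<le> sqrt (26 * fs_tail a c * real n / 2 ^ n)"
  shows "\<exists>C>0. \<exists>d>0. d \<le> 1 \<and>
    (\<forall>\<delta>. 0 < \<delta> \<longrightarrow> \<delta> \<le> d \<longrightarrow> Omega2 (\<lambda>t. c\<^sup>2 * t) x \<delta> \<le> ennreal (C * sqrt (\<delta> * ln (exp 1 / \<delta>))))"
proof -
  obtain n0 where "\<forall>n\<ge>n0. \<forall>p\<le>2 ^ (3 * n). \<forall>r\<le>2 ^ (4 * n). \<forall>j\<le>2 ^ (4 * n).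
      \<bar>fs_martingale a c sign_seq n p r j\<bar> \<le> sqrt (26 * fs_tail a c * real n / 2 ^ n)"
    using ev unfolding eventually_sequentially by blast
  then have n0: "\<And>n p r j. n0 \<le> n \<Longrightarrow> p \<le> 2 ^ (3 * n) \<Longrightarrow> r \<le> 2 ^ (4 * n) \<Longrightarrow> j \<le> 2 ^ (4 * n) \<Longrightarrow>
      \<bar>fs_martingale a c sign_seq n p r j\<bar> \<le> sqrt (26 * fs_tail a c * real n / 2 ^ n)"
    by blast
  define D where "D = 24 * holder_const\<^sup>2 + (a\<^sup>2 + 9 * c\<^sup>2) + sqrt (26 * fs_tail a c)"
  have D: "0 < D" using c fs_tail_pos[OF c, of a] by (auto simp: D_def intro!: add_nonneg_pos)
  \<comment> \<open>Every mesh l <= d then has scale n > n0; in particular n >= 1, so 2^{-n} <= n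
    2^{-n} and the deterministic errors are absorbed into the rate of the martingale.\<close>
  define d :: real where "d = 1 / 2 ^ Suc n0"
  have d: "0 < d" "d \<le> 1" using one_le_power[of "2::real" "Suc n0"] by (simp_all add: d_def)
  have bound: "\<bar>quad_var (shifted_grid l s) x t - c\<^sup>2 * t\<bar> \<le> 2 * D * sqrt (l * ln (exp 1 / l))"
    if l: "0 < l" "l \<le> d" and s: "0 \<le> s" "s < l" and t: "0 \<le> t" "t \<le> 1" for l s t
  proof -
    obtain n where n: "1 / 2 ^ Suc n < l" "l \<le> 1 / 2 ^ n" using dyadic_scale[of l] l d by auto
    have "1 / 2 ^ Suc n < (1 / 2 ^ Suc n0 :: real)" using n(1) l(2) unfolding d_def by (rule less_le_trans)
    then have "(2::real) ^ Suc n0 < 2 ^ Suc n" by (simp add: field_simps)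
    then have "n0 < n" by simp
    define Q where "Q = sqrt (real n / 2 ^ n)"
    have n1: "1 \<le> real n" using \<open>n0 < n\<close> by simp
    have "1 / 2 ^ n \<le> real n / 2 ^ n" using n1 by (intro divide_right_mono) auto
    then have 1: "sqrt (1 / 2 ^ n) \<le> Q" unfolding Q_def by (rule real_sqrt_le_mono)
    have "1 / 2 ^ n \<le> sqrt (1 / 2 ^ n)"
    proof (rule real_le_rsqrt)
      have "1 / 2 ^ n * (1 / 2 ^ n) \<le> 1 / 2 ^ n * (1::real)" by (intro mult_left_mono) auto
      then show "(1 / 2 ^ n)\<^sup>2 \<le> (1 / 2 ^ n :: real)" by (simp only: power2_eq_square mult_1_right)
    qed
    then have 2: "1 / 2 ^ n \<le> Q" using 1 by linarith
    have "\<bar>quad_var (shifted_grid l s) x t - c\<^sup>2 * t\<bar> \<le>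
        24 * holder_const\<^sup>2 * sqrt (1 / 2 ^ n) + (a\<^sup>2 + 9 * c\<^sup>2) / 2 ^ n + sqrt (26 * fs_tail a c * real n / 2 ^ n)"
      using \<open>n0 < n\<close> by (intro quad_var_shifted_grid_estimate[OF path_holder _ path_grid sign_seq_power2 n0 n s t]) auto
    also have "(a\<^sup>2 + 9 * c\<^sup>2) / 2 ^ n = (a\<^sup>2 + 9 * c\<^sup>2) * (1 / 2 ^ n)" by simp
    also have "sqrt (26 * fs_tail a c * real n / 2 ^ n) = sqrt (26 * fs_tail a c) * Q"
      by (simp add: Q_def flip: real_sqrt_mult)
    also have "24 * holder_const\<^sup>2 * sqrt (1 / 2 ^ n) + (a\<^sup>2 + 9 * c\<^sup>2) * (1 / 2 ^ n) + sqrt (26 * fs_tail a c) * Q \<le>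
        24 * holder_const\<^sup>2 * Q + (a\<^sup>2 + 9 * c\<^sup>2) * Q + sqrt (26 * fs_tail a c) * Q"
      using 1 2 by (intro add_mono mult_left_mono order_refl) auto
    also have "\<dots> = D * Q" by (simp add: D_def algebra_simps)
    also have "Q \<le> sqrt (4 * (l * ln (exp 1 / l)))"
      unfolding Q_def by (intro real_sqrt_le_mono dyadic_scale_le n)
    also have "\<dots> = 2 * sqrt (l * ln (exp 1 / l))" by (simp add: real_sqrt_mult)
    finally show ?thesis using D by (simp add: mult_left_mono mult_ac)
  qed
  have "Omega2 (\<lambda>t. c\<^sup>2 * t) x \<delta> \<le> ennreal (2 * D * sqrt (\<delta> * ln (exp 1 / \<delta>)))" if \<delta>: "0 < \<delta>" "\<delta> \<le> d" for \<delta>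
    unfolding Omega2_def
  proof (intro SUP_least ennreal_leI)
    fix l s t assume l: "l \<in> {l. 0 < l \<and> l \<le> 1 \<and> l \<le> \<delta>}" and s: "s \<in> {0..<l}" and t: "t \<in> {0..1::real}"
    have "\<bar>quad_var (shifted_grid l s) x t - c\<^sup>2 * t\<bar> \<le> 2 * D * sqrt (l * ln (exp 1 / l))"
      using l s t \<delta> by (intro bound) auto
    also have "\<dots> \<le> 2 * D * sqrt (\<delta> * ln (exp 1 / \<delta>))"
      using l \<delta> d D by (intro mult_left_mono real_sqrt_le_mono mult_ln_mono) auto
    finally show "\<bar>quad_var (shifted_grid l s) x t - c\<^sup>2 * t\<bar> \<le> 2 * D * sqrt (\<delta> * ln (exp 1 / \<delta>))" .
  qed
  then show ?thesis using D d by (intro exI[of _ "2 * D"] exI[of _ d] conjI) auto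
qed

end

section \<open>Dyadic grids as shifted grids, and the bound on \<open>R2\<close>\<close>

lemma dyadic_subgrid_eq:
  assumes "1 \<le> b" "r < b"
  shows "dyadic_subgrid m b r = shifted_grid (real b / 2 ^ m) (real r / 2 ^ m)"
proof -
  have scale: "real r / 2 ^ m + of_int k * (real b / 2 ^ m) = of_int (int r + k * int b) / 2 ^ m" for k
    by (simp add: add_divide_distrib)
  have less_1: "of_int z / 2 ^ m < (1::real) \<longleftrightarrow> z < 2 ^ m" for z
  proof -
    have "of_int z / 2 ^ m < (1::real) \<longleftrightarrow> of_int z < (of_int (2 ^ m) :: real)" by (simp add: pos_divide_less_eq)
    then show ?thesis by (simp only: of_int_less_iff)
  qed
  have pos: "(0::real) < of_int z / 2 ^ m \<longleftrightarrow> 0 < z" for z by (simp add: zero_less_divide_iff)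
  have "{real j / 2 ^ m | j. 1 \<le> j \<and> j < 2 ^ m \<and> [j = r] (mod b)} =
      {of_int (int r + k * int b) / 2 ^ m | k. 0 < int r + k * int b \<and> int r + k * int b < 2 ^ m}"
  proof (intro equalityI subsetI)
    fix y assume "y \<in> {real j / 2 ^ m | j. 1 \<le> j \<and> j < 2 ^ m \<and> [j = r] (mod b)}"
    then obtain j where j: "y = real j / 2 ^ m" "1 \<le> j" "j < 2 ^ m" "j mod b = r"
      using assms by (auto simp: cong_def)
    have "j = r + j div b * b" using div_mult_mod_eq[of j b] j(4) by linarith
    from arg_cong[OF this, of int] have eq: "int j = int r + int (j div b) * int b"
      by (simp only: of_nat_add of_nat_mult)
    have "int j < int (2 ^ m)" using j(3) by (simp only: of_nat_less_iff)
    then show "y \<in> {of_int (int r + k * int b) / 2 ^ m | k. 0 < int r + k * int b \<and> int r + k * int b < 2 ^ m}"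
      using j(1,2) unfolding mem_Collect_eq
      by (intro exI[of _ "int (j div b)"], unfold eq[symmetric]) simp
  next
    fix y :: real assume "y \<in> {of_int (int r + k * int b) / 2 ^ m | k. 0 < int r + k * int b \<and> int r + k * int b < 2 ^ m}"
    then obtain k where k: "y = of_int (int r + k * int b) / 2 ^ m" "0 < int r + k * int b" "int r + k * int b < 2 ^ m"
      by blast
    define j where "j = nat (int r + k * int b)"
    have j: "int j = int r + k * int b" using k(2) by (simp add: j_def)
    have "int (j mod b) = int (r mod b)" by (simp add: zmod_int j)
    then have "[j = r] (mod b)" by (simp only: of_nat_eq_iff cong_def)
    moreover have "1 \<le> j" using j k(2) by linarith
    moreover have "int j < int (2 ^ m)" using j k(3) by simp
    then have "j < 2 ^ m" by (simp only: of_nat_less_iff)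
    moreover have "y = real j / 2 ^ m" unfolding k(1) j[symmetric] by simp
    ultimately show "y \<in> {real j / 2 ^ m | j. 1 \<le> j \<and> j < 2 ^ m \<and> [j = r] (mod b)}" by blast
  qed
  then show ?thesis unfolding dyadic_subgrid_def shifted_grid_def scale less_1 pos by simp
qed

lemma dyadic_grid_eq: "dyadic_grid m = shifted_grid (1 / 2 ^ m) 0"
proof -
  have "dyadic_grid m = dyadic_subgrid m 1 0"
  proof (intro equalityI subsetI)
    fix y assume "y \<in> dyadic_grid m"
    then obtain j where j: "y = real j / 2 ^ m" "j \<le> 2 ^ m" by (auto simp: dyadic_grid_def)
    consider "j = 0" | "j = 2 ^ m" | "1 \<le> j" "j < 2 ^ m" using j(2) by linarith
    then show "y \<in> dyadic_subgrid m 1 0"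
      using j by cases (auto simp: dyadic_subgrid_def cong_def)
  next
    fix y assume "y \<in> dyadic_subgrid m 1 0"
    then consider "y = 0" | "y = 1" | j where "y = real j / 2 ^ m" "j < 2 ^ m"
      by (auto simp: dyadic_subgrid_def)
    then show "y \<in> dyadic_grid m"
    proof cases
      case 1
      then show ?thesis by (auto simp: dyadic_grid_def intro!: exI[of _ 0])
    next
      case 2
      then show ?thesis by (auto simp: dyadic_grid_def intro!: exI[of _ "2 ^ m"])
    qed (auto simp: dyadic_grid_def)
  qed
  then show ?thesis by (simp add: dyadic_subgrid_eq)
qed

lemma quad_var_le_Omega2:
  assumes "0 < l" "l \<le> 1" "l \<le> \<delta>" "0 \<le> s" "s < l" "0 \<le> t" "t \<le> 1"
  shows "ennreal \<bar>quad_var (shifted_grid l s) x t - A t\<bar> \<le> Omega2 A x \<delta>"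
  unfolding Omega2_def
  by (rule SUP_upper2[of l], use assms in simp, rule SUP_upper2[of s], use assms in simp,
      rule SUP_upper2[of t]) (use assms in simp_all)

text \<open>Both grids have mesh at most 1 / L, because b L <= 2^m and 2^{-m} <= b 2^{-m}; they are
  compared through \<open>A t\<close>. The bound holds for every m and so for the limit
  superior.\<close>

lemma R2_le_Omega2:
  assumes "1 \<le> L"
  shows "R2 L x \<le> 2 * Omega2 A x (1 / real L)"
  unfolding R2_def
proof (rule Limsup_bounded, rule always_eventually, intro allI SUP_least)
  fix m b r and t :: real assume b: "b \<in> {L..2 ^ m div L}" and r: "r \<in> {..<b}" and t: "t \<in> {0..1}"
  let ?V = "quad_var (dyadic_subgrid m b r) x t" and ?T = "quad_var (dyadic_grid m) x t"
  have "b * L \<le> 2 ^ m" using b assms by (auto simp: less_eq_div_iff_mult_less_eq)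
  then have "real (b * L) \<le> real (2 ^ m)" by (simp only: of_nat_le_iff)
  then have bL: "real b / 2 ^ m \<le> 1 / real L" using assms by (simp add: field_simps)
  have "1 \<le> real b" using b assms by auto
  then have "1 / 2 ^ m \<le> real b / 2 ^ m" by (intro divide_right_mono) auto
  then have mL: "1 / 2 ^ m \<le> 1 / real L" using bL by linarith
  have L1: "1 / real L \<le> 1" using assms by simp
  have V: "ennreal \<bar>?V - A t\<bar> \<le> Omega2 A x (1 / real L)"
    using b r t assms bL L1 by (subst dyadic_subgrid_eq) (auto intro!: quad_var_le_Omega2 divide_strict_right_mono intro: order_trans)
  have T: "ennreal \<bar>?T - A t\<bar> \<le> Omega2 A x (1 / real L)"
    unfolding dyadic_grid_eq using t mL by (intro quad_var_le_Omega2) auto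
  have "ennreal \<bar>?V - ?T\<bar> \<le> ennreal (\<bar>?V - A t\<bar> + \<bar>?T - A t\<bar>)" by (intro ennreal_leI) linarith
  also have "\<dots> = ennreal \<bar>?V - A t\<bar> + ennreal \<bar>?T - A t\<bar>" by (simp add: ennreal_plus)
  also have "\<dots> \<le> 2 * Omega2 A x (1 / real L)" unfolding mult_2 by (intro add_mono V T)
  finally show "ennreal \<bar>?V - ?T\<bar> \<le> 2 * Omega2 A x (1 / real L)" .
qed

lemma (in prob_space) AE_rademacher:
  assumes [measurable]: "X \<in> borel_measurable M"
    and "prob {\<omega> \<in> space M. X \<omega> = 1} = 1 / 2" "prob {\<omega> \<in> space M. X \<omega> = - 1} = 1 / 2"
  shows "AE \<omega> in M. X \<omega> = - 1 \<or> X \<omega> = (1::real)"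
proof -
  have "prob ({\<omega> \<in> space M. X \<omega> = 1} \<union> {\<omega> \<in> space M. X \<omega> = - 1}) = 1"
    using assms by (subst finite_measure_Union) auto
  from AE_prob_1[OF this] show ?thesis by eventually_elim auto
qed

theorem theorem6p11:
  fixes M :: "'w measure"
    and \<xi> :: "nat \<Rightarrow> nat \<Rightarrow> 'w \<Rightarrow> real"
    and X :: "'w \<Rightarrow> real \<Rightarrow> real"
    and a c :: real
  assumes "prob_space M"
    and "prob_space.indep_vars M (\<lambda>_. borel) (\<lambda>(m, k). \<xi> m k) {(m, k). k < 2 ^ m}"
    and "\<And>m k. k < 2 ^ m \<Longrightarrow> measure M {\<omega> \<in> space M. \<xi> m k \<omega> = 1} = 1 / 2"
    and "\<And>m k. k < 2 ^ m \<Longrightarrow> measure M {\<omega> \<in> space M. \<xi> m k \<omega> = - 1} = 1 / 2"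
    and "c \<noteq> 0"
    and "\<And>\<omega> t. \<omega> \<in> space M \<Longrightarrow> t \<in> {0..1} \<Longrightarrow>
           X \<omega> t = X \<omega> 0 + a * t + c * (\<Sum>m. \<Sum>k<2 ^ m. \<xi> m k \<omega> * faber_schauder m k t)"
  shows "(AE \<omega> in M. X \<omega> \<in> rough_paths2) \<and>
         (AE \<omega> in M. \<forall>t\<in>{0..1}. rough_qv (X \<omega>) t = c\<^sup>2 * t) \<and>
         (AE \<omega> in M. \<exists>C>0. \<forall>\<^sub>F \<delta> in at_right 0.
            Omega2 (\<lambda>t. c\<^sup>2 * t) (X \<omega>) \<delta> \<le> ennreal (C * sqrt (\<delta> * ln (exp 1 / \<delta>)))) \<and>
         (AE \<omega> in M. \<exists>C>0. \<forall>\<^sub>F L in sequentially.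
            R2 L (X \<omega>) \<le> ennreal (C * sqrt (ln (exp 1 * real L) / real L))) \<and>
         (AE \<omega> in M. (\<lambda>L. R2 L (X \<omega>)) \<longlonglongrightarrow> 0)"
proof -
  interpret prob_space M by fact
  let ?I = "{(m, k). k < 2 ^ m} :: (nat \<times> nat) set"
  define \<eta> where "\<eta> = (\<lambda>i. \<xi> (fs_level i) (fs_position i))"
  have meas: "\<xi> m k \<in> borel_measurable M" if "k < 2 ^ m" for m k
    using assms(2) that unfolding indep_vars_def by auto
  have sign: "AE \<omega> in M. \<xi> m k \<omega> = - 1 \<or> \<xi> m k \<omega> = 1" if "k < 2 ^ m" for m k
    using that assms(3,4) meas by (intro AE_rademacher) auto
  have signs: "AE \<omega> in M. \<forall>m. \<forall>k\<in>{..<2 ^ m}. \<xi> m k \<omega> = - 1 \<or> \<xi> m k \<omega> = 1"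
    unfolding AE_all_countable by (intro allI AE_finite_allI) (auto intro: sign)
  then have signs': "AE \<omega> in M. \<forall>i. \<eta> i \<omega> = - 1 \<or> \<eta> i \<omega> = 1"
    by eventually_elim (auto simp: \<eta>_def fs_position_less)
  have range: "range (\<lambda>i. (fs_level i, fs_position i)) \<subseteq> ?I" using fs_position_less by auto
  have unif: "prob {\<omega> \<in> space M. \<forall>i<P. \<eta> i \<omega> = \<sigma> i} = 1 / 2 ^ P" if "\<sigma> \<in> sign_vectors P" for P \<sigma>
    using prob_sign_vector[OF assms(2) _ range, of \<sigma> P] that assms(3,4)
    by (auto simp: inj_def fs_index_inj \<eta>_def)
  have "AE \<omega> in M. \<forall>\<^sub>F n in sequentially. \<forall>p\<le>2 ^ (3 * n). \<forall>r\<le>2 ^ (4 * n). \<forall>j\<le>2 ^ (4 * n).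
      \<bar>fs_martingale a c (\<lambda>i. \<eta> i \<omega>) n p r j\<bar> \<le> sqrt (26 * fs_tail a c * real n / 2 ^ n)"
    by (intro AE_fs_martingale_le unif signs' assms(5)) (auto simp: \<eta>_def intro: meas fs_position_less)
  \<comment> \<open>The bound is kept on a whole interval of \<delta> because the estimate of
    \<open>R2\<close> evaluates it at \<delta> = 1 / L.\<close>
  then have "AE \<omega> in M. continuous_on {0..1} (X \<omega>) \<and> (\<exists>C>0. \<exists>d>0. d \<le> 1 \<and>
      (\<forall>\<delta>. 0 < \<delta> \<longrightarrow> \<delta> \<le> d \<longrightarrow> Omega2 (\<lambda>t. c\<^sup>2 * t) (X \<omega>) \<delta> \<le> ennreal (C * sqrt (\<delta> * ln (exp 1 / \<delta>)))))"
    using signs AE_space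
  proof eventually_elim
    case (elim \<omega>)
    interpret faber_schauder_series "\<lambda>m k. \<xi> m k \<omega>" a c "X \<omega>"
    proof
      show "\<xi> m k \<omega> = - 1 \<or> \<xi> m k \<omega> = 1" if "k < 2 ^ m" for m k using elim(2) that by simp
      show "X \<omega> t = X \<omega> 0 + a * t + c * (\<Sum>m. \<Sum>k<2 ^ m. \<xi> m k \<omega> * faber_schauder m k t)"
        if "0 \<le> t" "t \<le> 1" for t
        using that by (intro assms(6)[OF elim(3)]) simp
    qed
    have "sign_seq = (\<lambda>i. \<eta> i \<omega>)" by (simp add: sign_seq_def \<eta>_def fun_eq_iff)
    with elim(1) have "\<forall>\<^sub>F n in sequentially. \<forall>p\<le>2 ^ (3 * n). \<forall>r\<le>2 ^ (4 * n). \<forall>j\<le>2 ^ (4 * n).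
        \<bar>fs_martingale a c sign_seq n p r j\<bar> \<le> sqrt (26 * fs_tail a c * real n / 2 ^ n)" by simp
    from conjI[OF path_continuous Omega2_bound[OF assms(5) this]] show ?case .
  qed
  then have "AE \<omega> in M. X \<omega> \<in> rough_paths2 \<and> (\<forall>t\<in>{0..1}. rough_qv (X \<omega>) t = c\<^sup>2 * t) \<and>
      (\<exists>C>0. \<forall>\<^sub>F \<delta> in at_right 0. Omega2 (\<lambda>t. c\<^sup>2 * t) (X \<omega>) \<delta> \<le> ennreal (C * sqrt (\<delta> * ln (exp 1 / \<delta>)))) \<and>
      (\<exists>C>0. \<forall>\<^sub>F L in sequentially. R2 L (X \<omega>) \<le> ennreal (C * sqrt (ln (exp 1 * real L) / real L))) \<and>
      (\<lambda>L. R2 L (X \<omega>)) \<longlonglongrightarrow> 0"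
  proof eventually_elim
    case (elim \<omega>)
    then obtain C d where C: "0 < C" "0 < d" "d \<le> 1"
      and Om: "\<And>\<delta>. 0 < \<delta> \<Longrightarrow> \<delta> \<le> d \<Longrightarrow> Omega2 (\<lambda>t. c\<^sup>2 * t) (X \<omega>) \<delta> \<le> ennreal (C * sqrt (\<delta> * ln (exp 1 / \<delta>)))"
      by blast
    have ev: "\<forall>\<^sub>F \<delta> in at_right 0. Omega2 (\<lambda>t. c\<^sup>2 * t) (X \<omega>) \<delta> \<le> ennreal (C * sqrt (\<delta> * ln (exp 1 / \<delta>)))"
      using C(2) by (intro eventually_at_rightI[of 0 d]) (auto intro: Om)
    have "((\<lambda>\<delta>. C * sqrt (\<delta> * ln (exp 1 / \<delta>))) \<longlongrightarrow> 0) (at_right 0)" by real_asymp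
    then have Om_lim: "((\<lambda>\<delta>. ennreal (C * sqrt (\<delta> * ln (exp 1 / \<delta>)))) \<longlongrightarrow> 0) (at_right 0)"
      using tendsto_ennrealI by fastforce
    have "((\<lambda>\<delta>. Omega2 (\<lambda>t. c\<^sup>2 * t) (X \<omega>) \<delta>) \<longlongrightarrow> 0) (at_right 0)"
      by (rule tendsto_sandwich[OF _ ev tendsto_const Om_lim]) simp
    then have qv: "is_rough_qv (X \<omega>) (\<lambda>t. c\<^sup>2 * t)"
      using assms(5) by (auto simp: is_rough_qv_def mono_on_def mult_left_mono intro!: continuous_intros)
    have R: "\<forall>\<^sub>F L in sequentially. R2 L (X \<omega>) \<le> ennreal (2 * C * sqrt (ln (exp 1 * real L) / real L))"
    proof -
      have "\<forall>\<^sub>F L in sequentially. 1 / real L < d" using C(2) by real_asymp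
      then show ?thesis using eventually_ge_at_top[of 1]
      proof eventually_elim
        case (elim L)
        have "R2 L (X \<omega>) \<le> 2 * Omega2 (\<lambda>t. c\<^sup>2 * t) (X \<omega>) (1 / real L)" using elim by (intro R2_le_Omega2) auto
        also have "\<dots> \<le> 2 * ennreal (C * sqrt (1 / real L * ln (exp 1 / (1 / real L))))"
          using elim by (intro mult_left_mono Om) auto
        also have "\<dots> = ennreal (2 * C * sqrt (ln (exp 1 * real L) / real L))"
          using C by (simp add: ennreal_mult' mult.assoc)
        finally show ?case .
      qed
    qed
    have "(\<lambda>L. 2 * C * sqrt (ln (exp 1 * real L) / real L)) \<longlonglongrightarrow> 0" by real_asymp
    then have R_lim: "(\<lambda>L. ennreal (2 * C * sqrt (ln (exp 1 * real L) / real L))) \<longlonglongrightarrow> 0"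
      using tendsto_ennrealI by fastforce
    have "(\<lambda>L. R2 L (X \<omega>)) \<longlonglongrightarrow> 0"
      by (rule tendsto_sandwich[OF _ R tendsto_const R_lim]) simp
    moreover have "X \<omega> \<in> rough_paths2" using elim qv by (auto simp: rough_paths2_def)
    moreover have "\<forall>t\<in>{0..1}. rough_qv (X \<omega>) t = c\<^sup>2 * t" using rough_qv_eq[OF qv] by blast
    moreover have "0 < 2 * C" using C by simp
    ultimately show ?case using ev R C(1) by blast
  qed
  then show ?thesis unfolding AE_conj_iff by blast
qed

end
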